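(* Let $\phi$, $F$ and $j$ satisfy the standing assumptions stated in the context, and let $d_N^1:=\{(x,x):x\in\mathbb{R}^N\}$. Assume that: (i) if $z\in D(j)$ then $z+\zeta\in D(j)$ and $j(z+\zeta)=j(z)$ for all $\zeta\in d_N^1$; (ii) $F(t,u)$ is $\omega_i$-periodic ($\omega_i>0$) with respect to each component $u_i$ of $u$ ($i=1,\dots,N$), for all $t\in[0,T]$. Then, for any given $h\in C([0,T];\mathbb{R}^N)$ with $\frac1T\int_0^Th(t)\,dt=0$, the system $$-[\phi(u')]'=\nabla_uF(t,u)+h(t)\quad\text{in }[0,T]$$ has at least one solution satisfying the boundary condition $$\big(\phi(u')(0),-\phi(u')(T)\big)\in\partial j(u(0),u(T)).$$
   Context: $N\ge 1$ is an integer, $T>0$, $0<a<\infty$; $|\cdot|$ is the Euclidean norm on $\mathbb{R}^N$; $B_a$ is the open ball of radius $a$ centered at $0$. Standing assumptions. (1) $\phi$ is a homeomorphism from $B_a$ onto $\mathbb{R}^N$ with $\phi(0)=0$ and $\phi=\nabla\Phi$ on $B_a$, where $\Phi:\overline{B}_a\to(-\infty,0]$ is of class $C^1$ on $B_a$, and continuous and strictly convex on $\overline{B}_a$. (2) $F=F(t,u):[0,T]\times\mathbb{R}^N\to\mathbb{R}$ is continuous, $\nabla_uF$ exists and is continuous on $[0,T]\times\mathbb{R}^N$, and $F(\cdot,0)=0$. (3) $j:\mathbb{R}^N\times\mathbb{R}^N\to(-\infty,+\infty]$ is proper, convex, lower semicontinuous, $j(0)=0$ and $0\in\partial j(0)$,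 where $\partial j$ is the subdifferential of convex analysis. $D(j)=\{z:j(z)<+\infty\}$. A solution of the boundary value problem is a function $u\in C^1([0,T];\mathbb{R}^N)$ with $|u'(t)|<a$ for all $t\in[0,T]$, $\phi(u')\in C^1([0,T];\mathbb{R}^N)$, $(u(0),u(T))\in D(\partial j)=\{z:\partial j(z)\ne\emptyset\}$, satisfying the system and the boundary condition; $\phi(u')(t)=\phi(u'(t))$. *)

theory Defs
  imports "HOL-Analysis.Analysis"
begin

definition has_C1_derivative_on ::
    "(real \<Rightarrow> 'a::real_normed_vector) \<Rightarrow> (real \<Rightarrow> 'a) \<Rightarrow> real set \<Rightarrow> bool"
  where "has_C1_derivative_on f f' S \<longleftrightarrow>
    (\<forall>t\<in>S. (f has_vector_derivative f' t) (at t within S)) \<and> continuous_on S f'"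

definition strictly_convex_on :: "'a::real_vector set \<Rightarrow> ('a \<Rightarrow> real) \<Rightarrow> bool"
  where "strictly_convex_on S f \<longleftrightarrow> convex S \<and>
    (\<forall>x\<in>S. \<forall>y\<in>S. \<forall>u>0. \<forall>v>0. x \<noteq> y \<longrightarrow> u + v = 1 \<longrightarrow>
      f (u *\<^sub>R x + v *\<^sub>R y) < u * f x + v * f y)"

definition eff_domain :: "('a \<Rightarrow> ereal) \<Rightarrow> 'a set"
  where "eff_domain j = {z. j z < \<infinity>}"

definition proper_fun :: "('a \<Rightarrow> ereal) \<Rightarrow> bool"
  where "proper_fun j \<longleftrightarrow> eff_domain j \<noteq> {} \<and> (\<forall>z. j z \<noteq> -\<infinity>)"

(* Intended for functions that do not take the value -\<infinity>; the weights are taken positive,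
   so the convention for 0 * \<infinity> plays no role. *)
definition ereal_convex :: "('a::real_vector \<Rightarrow> ereal) \<Rightarrow> bool"
  where "ereal_convex j \<longleftrightarrow>
    (\<forall>x y. \<forall>u>0. \<forall>v>0. u + v = 1 \<longrightarrow>
      j (u *\<^sub>R x + v *\<^sub>R y) \<le> ereal u * j x + ereal v * j y)"

definition lower_semicontinuous :: "('a::topological_space \<Rightarrow> ereal) \<Rightarrow> bool"
  where "lower_semicontinuous j \<longleftrightarrow> (\<forall>z. j z \<le> Liminf (at z) j)"

(* The inequality j \<xi> - j z \<ge> \<zeta> \<bullet> (\<xi> - z) with j z moved to the other side, which avoids
   \<infinity> - \<infinity>; for proper j the set is empty when j z = \<infinity>. *)
definition subdifferential :: "('a::real_inner \<Rightarrow> ereal) \<Rightarrow> 'a \<Rightarrow> 'a set"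
  where "subdifferential j z = {\<zeta>. \<forall>\<xi>. j z + ereal (\<zeta> \<bullet> (\<xi> - z)) \<le> j \<xi>}"

definition subdiff_domain :: "('a::real_inner \<Rightarrow> ereal) \<Rightarrow> 'a set"
  where "subdiff_domain j = {z. subdifferential j z \<noteq> {}}"

definition diagonal :: "('a \<times> 'a) set"
  where "diagonal = {(x, x) | x. True}"

(* G stands for the u-gradient of F; u' and w are the derivatives of u and of \<phi> \<circ> u' on {0..T},
   one-sided at the end points. *)
definition is_solution ::
    "real \<Rightarrow> real \<Rightarrow> ('a::euclidean_space \<Rightarrow> 'a) \<Rightarrow> (real \<Rightarrow> 'a \<Rightarrow> 'a) \<Rightarrow> (real \<Rightarrow> 'a) \<Rightarrow>
     ('a \<times> 'a \<Rightarrow> ereal) \<Rightarrow> (real \<Rightarrow> 'a) \<Rightarrow> bool"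
  where "is_solution T a \<phi> G h j u \<longleftrightarrow>
    (\<exists>u' w.
      has_C1_derivative_on u u' {0..T} \<and>
      (\<forall>t\<in>{0..T}. norm (u' t) < a) \<and>
      has_C1_derivative_on (\<lambda>t. \<phi> (u' t)) w {0..T} \<and>
      (u 0, u T) \<in> subdiff_domain j \<and>
      (\<forall>t\<in>{0..T}. - w t = G t (u t) + h t) \<and>
      (\<phi> (u' 0), - \<phi> (u' T)) \<in> subdifferential j (u 0, u T))"

end

theory Submission
  imports Defs "HOL-Complex_Analysis.Great_Picard"
begin

text \<open>
  The system is the Euler--Lagrange equation of
  \<open>u \<mapsto> \<integral> \<Phi>(u') - F(t,u) - h \<bullet> u dt + j (u 0, u T)\<close>. On a uniform grid of \<open>[0,T]\<close>, periodicity of \<open>F\<close>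
  together with the invariance of \<open>j\<close> along the diagonal makes the discretised functional attain its
  minimum over polygons with slopes of norm at most \<open>a\<close>. Since \<open>\<phi>(d) \<bullet> d\<close> tends to infinity as the norm of
  \<open>d\<close> tends to \<open>a\<close>, comparing a minimiser \<open>x\<close> with \<open>(1 - s) x\<close> shows that its slopes stay strictly
  inside the ball, so the first variation gives discrete equations
  \<open>\<phi>(d\<^sub>i) = q - H\<^sub>i - \<tau> \<Sum>\<^bsub>k\<le>i\<^esub> \<nabla>F(t\<^sub>k, x\<^sub>k)\<close> with \<open>H\<close> the primitive of \<open>h\<close> and \<open>(q, -q) \<in> \<partial>j(x\<^sub>0, x\<^sub>n)\<close>.
  Monotonicity of \<open>\<partial>j\<close> at \<open>0\<close> and coercivity of \<open>\<phi>\<close> bound \<open>q\<close> uniformly in the grid; by Arzela--Ascoli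
  the polygons converge to a solution of \<open>u' = \<phi>\<^sup>-\<^sup>1 (q - H - \<integral> \<nabla>F(s, u))\<close>.
\<close>

section \<open>One-sided derivatives and sequential lower semicontinuity\<close>

lemma GDERIV_directional:
  fixes f :: "'a::real_inner \<Rightarrow> real"
  assumes "GDERIV f x :> D"
  shows "((\<lambda>s. (f (x + s *\<^sub>R v) - f x) / s) \<longlongrightarrow> D \<bullet> v) (at_right 0)"
proof -
  have "((\<lambda>s. x + s *\<^sub>R v) has_derivative (\<lambda>s. s *\<^sub>R v)) (at 0)"
    by (auto intro!: derivative_eq_intros)
  moreover have "(f has_derivative (\<lambda>h. h \<bullet> D)) (at (x + 0 *\<^sub>R v))"
    using assms by (simp add: gderiv_def)
  ultimately have "((\<lambda>s. f (x + s *\<^sub>R v)) has_derivative (\<lambda>s. (s *\<^sub>R v) \<bullet> D)) (at 0)"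
    by (rule has_derivative_compose)
  then have "((\<lambda>s. f (x + s *\<^sub>R v)) has_field_derivative (D \<bullet> v)) (at 0)"
    by (simp add: has_field_derivative_def inner_commute mult_commute_abs)
  then have "((\<lambda>s. f (x + s *\<^sub>R v)) has_field_derivative (D \<bullet> v)) (at_right 0)"
    by (rule DERIV_subset) simp
  then show ?thesis
    by (simp add: has_field_derivative_iff)
qed

lemma GDERIV_isCont:
  fixes f :: "'a::real_inner \<Rightarrow> real"
  shows "GDERIV f x :> D \<Longrightarrow> isCont f x"
  unfolding gderiv_def by (rule has_derivative_continuous)

text \<open>A level strictly between \<open>\<beta>\<close> and \<open>j z\<close> would eventually
  lie above \<open>b\<close> and below \<open>j\<close> along \<open>Z\<close>. The bound varies
  with \<open>n\<close> so that the lemma serves both the attainment of the minimum and the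
  closedness of the subdifferential.\<close>

lemma lower_semicontinuous_limit_le:
  fixes j :: "'a::topological_space \<Rightarrow> ereal"
  assumes "lower_semicontinuous j" and Z: "Z \<longlonglongrightarrow> z"
    and le: "\<And>n. j (Z n) \<le> b n" and b: "b \<longlonglongrightarrow> \<beta>"
  shows "j z \<le> \<beta>"
proof (rule ccontr)
  assume "\<not> j z \<le> \<beta>"
  then obtain y where y: "\<beta> < y" "y < j z"
    using dense by (auto simp: not_le)
  have "\<forall>\<^sub>F x in at z. y < j x"
    using assms(1) y(2) unfolding lower_semicontinuous_def le_Liminf_iff by blast
  \<comment> \<open>\<open>Liminf (at z)\<close> ignores \<open>z\<close> itself, but
    \<open>Z\<close> may hit \<open>z\<close>; there the bound is \<open>y < j z\<close>.\<close>
  then have "\<forall>\<^sub>F x in nhds z. y < j x"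
    using y(2) unfolding eventually_at_filter by (auto elim!: eventually_mono)
  then have "\<forall>\<^sub>F n in sequentially. y < j (Z n)"
    using Z by (auto simp: filterlim_iff)
  moreover have "\<forall>\<^sub>F n in sequentially. b n < y"
    using b y(1) by (rule order_tendstoD)
  ultimately have "\<forall>\<^sub>F n in sequentially. False"
    by eventually_elim (use le in \<open>meson less_le_trans order.asym\<close>)
  then show False by simp
qed

section \<open>The discretised variational problem\<close>

definition slope :: "real \<Rightarrow> (nat \<Rightarrow> 'a::real_vector) \<Rightarrow> nat \<Rightarrow> 'a"
  where "slope \<tau> x i = (x (Suc i) - x i) /\<^sub>R \<tau>"

text \<open>A Riemann sum for the integral of \<Phi>(u') - F(t,u) - h \<bullet> u. The last term
  appears integrated by parts: \<open>b i\<close> will be the primitive of h at the i-th node, and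
  this primitive vanishes at 0 and T because h has mean zero.\<close>

definition energy ::
    "('a::real_inner \<Rightarrow> real) \<Rightarrow> nat \<Rightarrow> real \<Rightarrow> (nat \<Rightarrow> 'a \<Rightarrow> real) \<Rightarrow> (nat \<Rightarrow> 'a) \<Rightarrow> (nat \<Rightarrow> 'a) \<Rightarrow> real"
  where "energy \<Phi> n \<tau> f b x =
    (\<Sum>i<n. \<tau> * (\<Phi> (slope \<tau> x i) + b i \<bullet> slope \<tau> x i) - \<tau> * f i (x i))"

lemma slope_add_scaleR:
  "slope \<tau> (\<lambda>i. x i + s *\<^sub>R y i) i = slope \<tau> x i + s *\<^sub>R slope \<tau> y i"
  by (simp add: slope_def algebra_simps)

lemma slope_translate: "slope \<tau> (\<lambda>i. x i + c) i = slope \<tau> x i"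
  by (simp add: slope_def)

lemma norm_slope: "0 < \<tau> \<Longrightarrow> norm (slope \<tau> x i) = norm (x (Suc i) - x i) / \<tau>"
  unfolding slope_def by (simp add: divide_inverse mult.commute)

locale singular_potential =
  fixes a :: real and \<phi> \<psi> :: "'a::euclidean_space \<Rightarrow> 'a" and \<Phi> :: "'a \<Rightarrow> real"
    and j :: "'a \<times> 'a \<Rightarrow> ereal"
  assumes a_pos: "0 < a"
    and homeo: "homeomorphism (ball 0 a) UNIV \<phi> \<psi>"
    and phi_0: "\<phi> 0 = 0"
    and phi_grad: "\<And>x. norm x < a \<Longrightarrow> GDERIV \<Phi> x :> \<phi> x"
    and Phi_cont: "continuous_on (cball 0 a) \<Phi>"
    and Phi_convex: "strictly_convex_on (cball 0 a) \<Phi>"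
    and j_convex: "ereal_convex j"
    and j_lsc: "lower_semicontinuous j"
    and j_0: "j 0 = 0"
    and j_nonneg: "\<And>z. 0 \<le> j z"
    and j_diag: "\<And>x y c. j (x + c, y + c) = j (x, y)"
begin

section \<open>Monotonicity and coercivity of \<phi>, and convexity of \<open>j\<close> in real
  terms\<close>

lemma phi_cont: "continuous_on (ball 0 a) \<phi>"
  and psi_cont: "continuous_on UNIV \<psi>"
  and psi_phi: "norm z < a \<Longrightarrow> \<psi> (\<phi> z) = z"
  and phi_psi: "\<phi> (\<psi> p) = p"
  and norm_psi: "norm (\<psi> p) < a"
  using homeo unfolding homeomorphism_def by auto

text \<open>By convexity the difference quotients from \<open>z\<close> towards \<open>y\<close>
  stay below \<Phi>(y) - \<Phi>(z); let the step tend to 0. The point \<open>y\<close> may lie on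
  the sphere, where \<phi> has no meaning, which is the case needed for extremal slopes.\<close>

lemma tangent_le:
  assumes z: "norm z < a" and y: "norm y \<le> a"
  shows "\<Phi> z + \<phi> z \<bullet> (y - z) \<le> \<Phi> y"
proof (cases "y = z")
  case False
  have "((\<lambda>s. (\<Phi> (z + s *\<^sub>R (y - z)) - \<Phi> z) / s) \<longlongrightarrow> \<phi> z \<bullet> (y - z)) (at_right 0)"
    by (rule GDERIV_directional [OF phi_grad [OF z]])
  moreover have "\<forall>\<^sub>F s in at_right 0. (\<Phi> (z + s *\<^sub>R (y - z)) - \<Phi> z) / s \<le> \<Phi> y - \<Phi> z"
    using eventually_at_right_less [of 0] eventually_at_right_real [OF zero_less_one]
  proof eventually_elim
    case (elim s)
    then have "\<Phi> ((1 - s) *\<^sub>R z + s *\<^sub>R y) < (1 - s) * \<Phi> z + s * \<Phi> y"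
      using Phi_convex False z y unfolding strictly_convex_on_def by auto
    moreover have "(1 - s) *\<^sub>R z + s *\<^sub>R y = z + s *\<^sub>R (y - z)"
      by (simp add: algebra_simps)
    ultimately show ?case
      using elim by (simp add: field_simps)
  qed
  ultimately have "\<phi> z \<bullet> (y - z) \<le> \<Phi> y - \<Phi> z"
    by (rule tendsto_upperbound) simp
  then show ?thesis by simp
qed simp

lemma phi_monotone:
  assumes "norm z < a" "norm y < a"
  shows "0 \<le> (\<phi> z - \<phi> y) \<bullet> (z - y)"
  using tangent_le [of z y] tangent_le [of y z] assms by (simp add: algebra_simps)

lemma phi_inner_nonneg: "norm z < a \<Longrightarrow> 0 \<le> \<phi> z \<bullet> z"
  using phi_monotone [of z 0] phi_0 a_pos by simp

text \<open>Monotonicity is tested between \<open>d\<close> and the point \<open>z\<close> of norm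
  a/2 in the direction of \<phi>(d): then \<phi>(d) \<bullet> z = (a/2)|\<phi>(d)|, while \<phi>(z)
  \<bullet> (d - z) is bounded because \<phi> is bounded on the half ball.\<close>

lemma phi_coercive:
  obtains C where "0 \<le> C" "\<And>d. norm d < a \<Longrightarrow> a / 2 * norm (\<phi> d) - C \<le> \<phi> d \<bullet> d"
proof -
  have "compact (\<phi> ` cball 0 (a / 2))"
    using a_pos by (intro compact_continuous_image continuous_on_subset [OF phi_cont]) auto
  then have "bounded (\<phi> ` cball 0 (a / 2))" by (rule compact_imp_bounded)
  then obtain M where "\<forall>p\<in>\<phi> ` cball 0 (a / 2). norm p \<le> M" unfolding bounded_iff by blast
  then have M: "norm (\<phi> z) \<le> M" if "norm z \<le> a / 2" for z using that by simp
  have M0: "0 \<le> M" using M [of 0] a_pos phi_0 by simp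
  have "a / 2 * norm (\<phi> d) - M * (2 * a) \<le> \<phi> d \<bullet> d" if d: "norm d < a" for d
  proof (cases "\<phi> d = 0")
    case False
    define z where "z = (a / (2 * norm (\<phi> d))) *\<^sub>R \<phi> d"
    have nz: "norm z = a / 2" using False a_pos by (simp add: z_def)
    have "\<phi> d \<bullet> z = a / 2 * norm (\<phi> d)"
      using False by (simp add: z_def dot_square_norm power2_eq_square)
    moreover have "\<bar>\<phi> z \<bullet> (d - z)\<bar> \<le> M * (2 * a)"
    proof -
      have "\<bar>\<phi> z \<bullet> (d - z)\<bar> \<le> norm (\<phi> z) * norm (d - z)" by (rule Cauchy_Schwarz_ineq2)
      also have "\<dots> \<le> M * (2 * a)"
        using M [of z] nz d norm_triangle_ineq4 [of d z] a_pos M0 by (intro mult_mono) auto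
      finally show ?thesis .
    qed
    moreover have "0 \<le> (\<phi> d - \<phi> z) \<bullet> (d - z)"
      using phi_monotone d nz a_pos by simp
    ultimately show ?thesis by (simp add: inner_diff_left inner_diff_right)
  qed (use M0 a_pos in auto)
  then show ?thesis using that [of "M * (2 * a)"] M0 a_pos by simp
qed

text \<open>The inverse \<psi> maps the closed ball of radius \<open>M\<close> onto a compact subset
  of the open ball, on which the norm has a maximum below \<open>a\<close>.\<close>

lemma norm_bound_of_phi_bound:
  obtains r where "r < a" "\<And>z. norm z < a \<Longrightarrow> norm (\<phi> z) \<le> M \<Longrightarrow> norm z \<le> r"
proof -
  have "compact (\<psi> ` cball 0 M)"
    by (intro compact_continuous_image continuous_on_subset [OF psi_cont]) auto
  then have "compact (norm ` \<psi> ` cball 0 M)"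
    by (rule compact_continuous_image [rotated]) (intro continuous_intros)
  \<comment> \<open>The extra 0 keeps the set nonempty when \<open>M\<close> is negative.\<close>
  then have c: "compact (insert 0 (norm ` \<psi> ` cball 0 M))" by simp
  obtain r where r: "r \<in> insert 0 (norm ` \<psi> ` cball 0 M)"
      "\<And>s. s \<in> insert 0 (norm ` \<psi> ` cball 0 M) \<Longrightarrow> s \<le> r"
    using compact_attains_sup [OF c] by blast
  have "r < a" using r(1) norm_psi a_pos by auto
  moreover have "norm z \<le> r" if "norm z < a" "norm (\<phi> z) \<le> M" for z
  proof -
    have "norm (\<psi> (\<phi> z)) \<in> norm ` \<psi> ` cball 0 M" using that(2) by (intro imageI) simp
    then show ?thesis using r(2) [of "norm z"] psi_phi [OF that(1)] by simp
  qed
  ultimately show ?thesis using that by blast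
qed

lemma ereal_j: "j z < \<infinity> \<Longrightarrow> j z = ereal (real_of_ereal (j z))"
  using j_nonneg [of z] by (cases "j z") auto

lemma j_segment:
  assumes "j z < \<infinity>" "j z' < \<infinity>" "0 < s" "s < 1"
  shows "j ((1 - s) *\<^sub>R z + s *\<^sub>R z') < \<infinity>"
    and "real_of_ereal (j ((1 - s) *\<^sub>R z + s *\<^sub>R z'))
      \<le> (1 - s) * real_of_ereal (j z) + s * real_of_ereal (j z')"
proof -
  have "j ((1 - s) *\<^sub>R z + s *\<^sub>R z') \<le> ereal (1 - s) * j z + ereal s * j z'"
    using j_convex [unfolded ereal_convex_def, rule_format, of "1 - s" s z z'] assms(3,4) by simp
  also have "\<dots> = ereal ((1 - s) * real_of_ereal (j z) + s * real_of_ereal (j z'))"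
    by (subst ereal_j [OF assms(1)], subst ereal_j [OF assms(2)]) simp
  finally have *: "j ((1 - s) *\<^sub>R z + s *\<^sub>R z')
      \<le> ereal ((1 - s) * real_of_ereal (j z) + s * real_of_ereal (j z'))" .
  then show fin: "j ((1 - s) *\<^sub>R z + s *\<^sub>R z') < \<infinity>"
    using le_less_trans by fastforce
  show "real_of_ereal (j ((1 - s) *\<^sub>R z + s *\<^sub>R z'))
      \<le> (1 - s) * real_of_ereal (j z) + s * real_of_ereal (j z')"
    using * by (subst (asm) ereal_j [OF fin]) simp
qed

section \<open>Minimisers of the discrete functional: existence, interior slopes, first
  variation\<close>

definition minimiser ::
    "nat \<Rightarrow> real \<Rightarrow> (nat \<Rightarrow> 'a \<Rightarrow> real) \<Rightarrow> (nat \<Rightarrow> 'a) \<Rightarrow> (nat \<Rightarrow> 'a) \<Rightarrow> bool"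
  where "minimiser n \<tau> f b x \<longleftrightarrow>
    (\<forall>i<n. norm (slope \<tau> x i) \<le> a) \<and> j (x 0, x n) < \<infinity> \<and>
    (\<forall>y. (\<forall>i<n. norm (slope \<tau> y i) \<le> a) \<longrightarrow> j (y 0, y n) < \<infinity> \<longrightarrow>
      energy \<Phi> n \<tau> f b x + real_of_ereal (j (x 0, x n))
      \<le> energy \<Phi> n \<tau> f b y + real_of_ereal (j (y 0, y n)))"

lemma minimiser_exists:
  assumes tau: "0 < \<tau>"
    and f_cont: "\<And>i u. i < n \<Longrightarrow> isCont (f i) u"
    and periods: "\<And>c. \<exists>l. norm (c + l) \<le> B \<and> (\<forall>i<n. \<forall>u. f i (u + l) = f i u)"
  obtains x where "minimiser n \<tau> f b x" "norm (x 0) \<le> B"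
proof -
  define K where "K = {x :: nat \<Rightarrow> 'a. (\<forall>i<n. norm (slope \<tau> x i) \<le> a) \<and> norm (x 0) \<le> B}"
  define J where "J x = ereal (energy \<Phi> n \<tau> f b x) + j (x 0, x n)" for x
  have B0: "0 \<le> B" using periods [of 0] norm_ge_zero order_trans by blast
  have zK: "(\<lambda>i. 0) \<in> K" using B0 a_pos by (simp add: K_def slope_def)
  have "J ` K \<noteq> {}" using zK by blast
  then obtain v where v: "\<And>k. v k \<in> J ` K" "v \<longlonglongrightarrow> Inf (J ` K)"
    using Inf_as_limit [of "J ` K"] by blast
  then have "\<forall>k. \<exists>x\<in>K. v k = J x" by blast
  then obtain X where XK: "\<And>k. X k \<in> K" and vX: "\<And>k. v k = J (X k)" by metis
  have bound: "i \<le> n \<longrightarrow> norm (X k i) \<le> B + real i * (\<tau> * a)" for k i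
  proof (induction i)
    case 0
    then show ?case using XK [of k] by (simp add: K_def)
  next
    case (Suc i)
    show ?case
    proof
      assume i: "Suc i \<le> n"
      have "norm (slope \<tau> (X k) i) \<le> a" using XK [of k] i by (simp add: K_def)
      then have "norm (X k (Suc i) - X k i) \<le> \<tau> * a"
        using tau by (simp add: norm_slope pos_divide_le_eq mult.commute)
      then have "norm (X k (Suc i)) \<le> norm (X k i) + \<tau> * a"
        using norm_triangle_sub [of "X k (Suc i)" "X k i"] by linarith
      then show "norm (X k (Suc i)) \<le> B + real (Suc i) * (\<tau> * a)"
        using Suc i by (simp add: algebra_simps)
    qed
  qed
  have bound': "norm (X k i) \<le> B + real n * (\<tau> * a)" if "i \<in> {..n}" for k i
  proof -
    have "real i * (\<tau> * a) \<le> real n * (\<tau> * a)"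
      using that tau a_pos by (intro mult_right_mono) auto
    then show ?thesis using bound [of i k] that by simp
  qed
  have "\<exists>r. strict_mono r \<and> (\<forall>i\<le>n. \<exists>l. (\<lambda>k. X (r k) i) \<longlonglongrightarrow> l)"
  proof (rule function_convergent_subsequence [of "{..n}" X])
    show "norm (X k i) \<le> B + real n * (\<tau> * a)" if "i \<in> {..n}" for k i
      by (rule bound' [OF that])
  qed auto
  then obtain r where r: "strict_mono r" "\<forall>i\<le>n. \<exists>l. (\<lambda>k. X (r k) i) \<longlonglongrightarrow> l"
    by blast
  \<comment> \<open>Beyond \<open>n\<close> these values are unspecified; the functional only sees
    the nodes 0 to \<open>n\<close>.\<close>
  define x where "x i = lim (\<lambda>k. X (r k) i)" for i
  have x: "(\<lambda>k. X (r k) i) \<longlonglongrightarrow> x i" if "i \<le> n" for i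
  proof -
    have "convergent (\<lambda>k. X (r k) i)" using r(2) that by (simp add: convergent_def)
    then show ?thesis by (simp add: x_def convergent_LIMSEQ_iff)
  qed
  have sl: "(\<lambda>k. slope \<tau> (X (r k)) i) \<longlonglongrightarrow> slope \<tau> x i" if "i < n" for i
    unfolding slope_def using that by (intro tendsto_intros x) auto
  have xa: "norm (slope \<tau> x i) \<le> a" if "i < n" for i
    using XK that by (intro tendsto_upperbound [OF tendsto_norm [OF sl [OF that]]])
      (auto simp: K_def)
  have x0: "norm (x 0) \<le> B"
    using XK by (intro tendsto_upperbound [OF tendsto_norm [OF x]]) (auto simp: K_def)
  have en: "(\<lambda>k. energy \<Phi> n \<tau> f b (X (r k))) \<longlonglongrightarrow> energy \<Phi> n \<tau> f b x"
    unfolding energy_def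
  proof (intro tendsto_intros)
    fix i assume "i \<in> {..<n}"
    then have i: "i < n" by simp
    show "(\<lambda>k. \<Phi> (slope \<tau> (X (r k)) i)) \<longlonglongrightarrow> \<Phi> (slope \<tau> x i)"
      using XK i xa by (intro continuous_on_tendsto_compose [OF Phi_cont sl]) (auto simp: K_def)
    show "(\<lambda>k. slope \<tau> (X (r k)) i) \<longlonglongrightarrow> slope \<tau> x i" by (rule sl [OF i])
    show "(\<lambda>k. f i (X (r k) i)) \<longlonglongrightarrow> f i (x i)"
      by (rule isCont_tendsto_compose [OF f_cont [OF i] x]) (use i in simp)
  qed
  \<comment> \<open>The energy is finite and converges, so subtracting it leaves a convergent bound
    on \<open>j\<close> alone, to which lower semicontinuity applies.\<close>
  have "j (x 0, x n) \<le> Inf (J ` K) - ereal (energy \<Phi> n \<tau> f b x)"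
  proof (rule lower_semicontinuous_limit_le [OF j_lsc])
    show "(\<lambda>k. (X (r k) 0, X (r k) n)) \<longlonglongrightarrow> (x 0, x n)" by (intro tendsto_intros x) auto
    show "j (X (r k) 0, X (r k) n) \<le> J (X (r k)) - ereal (energy \<Phi> n \<tau> f b (X (r k)))" for k
      by (cases "j (X (r k) 0, X (r k) n)") (auto simp: J_def)
    have "(\<lambda>k. J (X (r k))) \<longlonglongrightarrow> Inf (J ` K)"
      using LIMSEQ_subseq_LIMSEQ [OF v(2) r(1)] by (simp add: vX o_def)
    then show "(\<lambda>k. J (X (r k)) - ereal (energy \<Phi> n \<tau> f b (X (r k))))
        \<longlonglongrightarrow> Inf (J ` K) - ereal (energy \<Phi> n \<tau> f b x)"
      using en by (intro tendsto_diff_ereal_general) auto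
  qed
  then have "J x \<le> Inf (J ` K)"
    unfolding J_def by (subst (asm) ereal_le_minus) (auto simp: add.commute)
  then have le: "J x \<le> J y" if "y \<in> K" for y
    using that by (meson INF_lower order_trans)
  have "J (\<lambda>i. 0) < \<infinity>" using j_0 by (simp add: J_def flip: zero_prod_def)
  then have "J x < \<infinity>" using le [OF zK] by (rule le_less_trans [rotated])
  then have fin: "j (x 0, x n) < \<infinity>" by (simp add: J_def less_top [symmetric])
  have "energy \<Phi> n \<tau> f b x + real_of_ereal (j (x 0, x n))
      \<le> energy \<Phi> n \<tau> f b y + real_of_ereal (j (y 0, y n))"
    if y: "\<forall>i<n. norm (slope \<tau> y i) \<le> a" "j (y 0, y n) < \<infinity>" for y
  proof -
    obtain l where l: "norm (y 0 + l) \<le> B" "\<forall>i<n. \<forall>u. f i (u + l) = f i u"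
      using periods by blast
    have "(\<lambda>i. y i + l) \<in> K" using y(1) l(1) by (simp add: K_def slope_translate)
    then have "J x \<le> J (\<lambda>i. y i + l)" by (rule le)
    also have "\<dots> = J y"
      using l(2) by (simp add: J_def energy_def slope_translate j_diag)
    finally show ?thesis
      unfolding J_def by (subst (asm) ereal_j [OF fin], subst (asm) ereal_j [OF y(2)]) simp
  qed
  then have "minimiser n \<tau> f b x" using xa fin by (simp add: minimiser_def)
  then show ?thesis using that x0 by blast
qed

text \<open>If some slope had norm \<open>a\<close>, compare \<open>x\<close> with (1 - s)x. By
  convexity and \<open>j 0 = 0\<close> the boundary term does not grow, so minimality bounds
  \<phi>((1 - s)d) \<bullet> d from above for the extremal slope d, uniformly for small s.
  Coercivity then keeps (1 - s)d in a fixed smaller ball, which is impossible as s tends to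
  0.\<close>

lemma minimiser_interior:
  assumes tau: "0 < \<tau>"
    and grad: "\<And>i u. i < n \<Longrightarrow> GDERIV (f i) u :> g i u"
    and min: "minimiser n \<tau> f b x"
    and m: "m < n"
  shows "norm (slope \<tau> x m) < a"
proof (rule ccontr)
  define d where "d = slope \<tau> x"
  assume "\<not> norm (slope \<tau> x m) < a"
  have da: "norm (d i) \<le> a" if "i < n" for i
    using min that by (simp add: minimiser_def d_def)
  with m \<open>\<not> norm (slope \<tau> x m) < a\<close> have dm: "norm (d m) = a"
    using d_def by force
  obtain C where C: "0 \<le> C" "\<And>d. norm d < a \<Longrightarrow> a / 2 * norm (\<phi> d) - C \<le> \<phi> d \<bullet> d"
    using phi_coercive by blast
  \<comment> \<open>\<open>D\<close> collects the difference quotients of the terms with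
    \<open>b\<close> and \<open>f\<close>, which have a finite limit \<open>L\<close>; the quotients
    of \<Phi> are kept apart in \<open>P\<close>, as \<Phi> need not be differentiable on the
    sphere.\<close>
  define D where "D s = (\<Sum>i<n. - (b i \<bullet> d i) - (f i (x i + s *\<^sub>R (- x i)) - f i (x i)) / s)" for s
  define L where "L = (\<Sum>i<n. - (b i \<bullet> d i) - g i (x i) \<bullet> (- x i))"
  have "(D \<longlongrightarrow> L) (at_right 0)"
    unfolding D_def L_def by (intro tendsto_intros GDERIV_directional grad) auto
  then have "\<forall>\<^sub>F s in at_right 0. D s < L + 1"
    by (rule order_tendstoD) simp
  \<comment> \<open>The value of |\<phi>| obtained by solving (a/2)|\<phi>| - C \<le> L + 1.\<close>
  define M where "M = (L + 1 + C) * 2 / a"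
  obtain r where r: "r < a" "\<And>z. norm z < a \<Longrightarrow> norm (\<phi> z) \<le> M \<Longrightarrow> norm z \<le> r"
    using norm_bound_of_phi_bound by blast
  have "\<forall>\<^sub>F s in at_right 0. (1 - s) * a \<le> r"
    using \<open>\<forall>\<^sub>F s in at_right 0. D s < L + 1\<close> eventually_at_right_real [OF zero_less_one]
  proof eventually_elim
    case (elim s)
    then have s: "0 < s" "s < 1" by auto
    define y where "y i = x i + s *\<^sub>R (- x i)" for i
    define P where "P i = (\<Phi> (d i + s *\<^sub>R (- d i)) - \<Phi> (d i)) / s" for i
    have sy: "slope \<tau> y i = d i + s *\<^sub>R (- d i)" for i
      unfolding y_def slope_add_scaleR by (simp add: d_def slope_def algebra_simps)
    have norm_sy: "norm (d i + s *\<^sub>R (- d i)) = (1 - s) * norm (d i)" for i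
    proof -
      have "d i + s *\<^sub>R (- d i) = (1 - s) *\<^sub>R d i" by (simp add: algebra_simps)
      then show ?thesis using s by simp
    qed
    have small: "norm (d i + s *\<^sub>R (- d i)) < a" if "i < n" for i
    proof -
      have "(1 - s) * norm (d i) \<le> (1 - s) * a" using da that s by simp
      also have "\<dots> < a" using s a_pos by (simp add: algebra_simps)
      finally show ?thesis by (simp only: norm_sy)
    qed
    have jx: "j (x 0, x n) < \<infinity>" using min by (simp add: minimiser_def)
    have j0: "j 0 < \<infinity>" "real_of_ereal (j 0) = 0" using j_0 by auto
    have z: "(1 - s) *\<^sub>R (x 0, x n) + s *\<^sub>R 0 = (y 0, y n)"
      by (simp add: y_def algebra_simps)
    have "0 \<le> real_of_ereal (j (x 0, x n))"
      using j_nonneg by (simp add: real_of_ereal_pos)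
    then have "(1 - s) * real_of_ereal (j (x 0, x n)) \<le> real_of_ereal (j (x 0, x n))"
      using s by (simp add: mult_left_le_one_le)
    then have jy: "j (y 0, y n) < \<infinity>" "real_of_ereal (j (y 0, y n)) \<le> real_of_ereal (j (x 0, x n))"
      using j_segment [OF jx j0(1) s] j0(2) unfolding z by auto
    have "\<forall>i<n. norm (slope \<tau> y i) \<le> a" using small by (simp add: sy less_imp_le)
    then have "energy \<Phi> n \<tau> f b x \<le> energy \<Phi> n \<tau> f b y"
      using min jy unfolding minimiser_def by force
    moreover have "energy \<Phi> n \<tau> f b y - energy \<Phi> n \<tau> f b x = \<tau> * s * ((\<Sum>i<n. P i) + D s)"
      unfolding energy_def D_def sum_subtractf [symmetric] sum.distrib [symmetric] sum_distrib_left
      by (rule sum.cong [OF refl])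
        (use s in \<open>simp add: sy P_def y_def d_def [symmetric] field_simps inner_diff_right\<close>)
    ultimately have "0 \<le> \<tau> * s * ((\<Sum>i<n. P i) + D s)" by simp
    then have nonneg: "0 \<le> (\<Sum>i<n. P i) + D s"
      using tau s by (simp add: zero_le_mult_iff) (smt (verit) mult_pos_pos)
    \<comment> \<open>The tangent is taken at the shrunken slope, which is interior, and evaluated
      at \<open>d i\<close>, which may lie on the sphere.\<close>
    have P: "P i \<le> - (\<phi> (d i + s *\<^sub>R (- d i)) \<bullet> d i)" if "i < n" for i
      using tangent_le [OF small da, OF that that] s
      by (simp add: P_def field_simps)
    have phi_d: "\<phi> (d i + s *\<^sub>R (- d i)) \<bullet> (d i + s *\<^sub>R (- d i)) = (1 - s) * (\<phi> (d i + s *\<^sub>R (- d i)) \<bullet> d i)" for i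
      by (simp add: algebra_simps)
    have phi_d': "\<phi> (d i + s *\<^sub>R (- d i)) \<bullet> (d i + s *\<^sub>R (- d i)) \<le> \<phi> (d i + s *\<^sub>R (- d i)) \<bullet> d i"
      and P0: "P i \<le> 0" if "i < n" for i
    proof -
      have "0 \<le> (1 - s) * (\<phi> (d i + s *\<^sub>R (- d i)) \<bullet> d i)"
        using phi_inner_nonneg [OF small [OF that]] by (simp only: phi_d)
      then have "0 \<le> \<phi> (d i + s *\<^sub>R (- d i)) \<bullet> d i"
        using s by (simp add: zero_le_mult_iff)
      then show "P i \<le> 0"
        "\<phi> (d i + s *\<^sub>R (- d i)) \<bullet> (d i + s *\<^sub>R (- d i)) \<le> \<phi> (d i + s *\<^sub>R (- d i)) \<bullet> d i"
        using P [OF that] s unfolding phi_d by (auto simp: mult_left_le_one_le)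
    qed
    have "(\<Sum>i<n. P i) = P m + (\<Sum>i\<in>{..<n} - {m}. P i)"
      using m by (intro sum.remove) auto
    also have "\<dots> \<le> P m" using P0 sum_nonpos [of "{..<n} - {m}" P] by simp
    finally have "(\<Sum>i<n. P i) \<le> P m" .
    then have "a / 2 * norm (\<phi> (d m + s *\<^sub>R (- d m))) \<le> L + 1 + C"
      using nonneg elim(1) P [OF m] phi_d' [OF m] C(2) [OF small [OF m]] by linarith
    then have "norm (\<phi> (d m + s *\<^sub>R (- d m))) \<le> M"
      using a_pos by (simp add: M_def field_simps)
    then have "norm (d m + s *\<^sub>R (- d m)) \<le> r" by (rule r(2) [OF small [OF m]])
    then show ?case by (simp only: norm_sy dm)
  qed
  moreover have "((\<lambda>s. (1 - s) * a) \<longlongrightarrow> (1 - 0) * a) (at_right 0)"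
    by (intro tendsto_intros)
  ultimately have "(1 - 0) * a \<le> r"
    by (intro tendsto_upperbound) auto
  then show False using r(1) by simp
qed

text \<open>The energy is differentiated from the right along x + s y, which is admissible for small
  s because the slopes of \<open>x\<close> are interior. The term with \<open>j\<close> is not
  differentiated: convexity bounds its increment by s times the full increment from \<open>x\<close>
  to x + y.\<close>

lemma minimiser_variation:
  assumes tau: "0 < \<tau>"
    and grad: "\<And>i u. i < n \<Longrightarrow> GDERIV (f i) u :> g i u"
    and min: "minimiser n \<tau> f b x"
    and jy: "j (x 0 + y 0, x n + y n) < \<infinity>"
  shows "0 \<le> (\<Sum>i<n. \<tau> * ((\<phi> (slope \<tau> x i) + b i) \<bullet> slope \<tau> y i) - \<tau> * (g i (x i) \<bullet> y i))
    + (real_of_ereal (j (x 0 + y 0, x n + y n)) - real_of_ereal (j (x 0, x n)))"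
proof -
  define d where "d = slope \<tau> x"
  define e where "e = slope \<tau> y"
  define \<Delta> where "\<Delta> = real_of_ereal (j (x 0 + y 0, x n + y n)) - real_of_ereal (j (x 0, x n))"
  define Q where "Q s = (\<Sum>i<n. \<tau> * ((\<Phi> (d i + s *\<^sub>R e i) - \<Phi> (d i)) / s + b i \<bullet> e i)
      - \<tau> * ((f i (x i + s *\<^sub>R y i) - f i (x i)) / s))" for s
  have da: "norm (d i) < a" if "i < n" for i
    unfolding d_def by (rule minimiser_interior [OF tau grad min that])
  have "(Q \<longlongrightarrow> (\<Sum>i<n. \<tau> * (\<phi> (d i) \<bullet> e i + b i \<bullet> e i) - \<tau> * (g i (x i) \<bullet> y i))) (at_right 0)"
    unfolding Q_def by (intro tendsto_intros GDERIV_directional grad phi_grad da) auto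
  then have lim: "((\<lambda>s. Q s + \<Delta>) \<longlongrightarrow>
      (\<Sum>i<n. \<tau> * (\<phi> (d i) \<bullet> e i + b i \<bullet> e i) - \<tau> * (g i (x i) \<bullet> y i)) + \<Delta>) (at_right 0)"
    by (intro tendsto_intros)
  have "\<forall>\<^sub>F s in at_right 0. norm (d i + s *\<^sub>R e i) < a" if "i < n" for i
  proof (rule order_tendstoD)
    show "((\<lambda>s. norm (d i + s *\<^sub>R e i)) \<longlongrightarrow> norm (d i + 0 *\<^sub>R e i)) (at_right 0)"
      by (intro tendsto_intros)
  qed (use da that in simp)
  then have "\<forall>\<^sub>F s in at_right 0. \<forall>i\<in>{..<n}. norm (d i + s *\<^sub>R e i) < a"
    by (intro eventually_ball_finite) auto
  then have "\<forall>\<^sub>F s in at_right 0. 0 \<le> Q s + \<Delta>"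
    using eventually_at_right_real [OF zero_less_one]
  proof eventually_elim
    case (elim s)
    then have s: "0 < s" "s < 1" by auto
    define z where "z i = x i + s *\<^sub>R y i" for i
    have sz: "slope \<tau> z i = d i + s *\<^sub>R e i" for i
      unfolding z_def slope_add_scaleR by (simp add: d_def e_def)
    have jx: "j (x 0, x n) < \<infinity>" using min by (simp add: minimiser_def)
    have eq: "(1 - s) *\<^sub>R (x 0, x n) + s *\<^sub>R (x 0 + y 0, x n + y n) = (z 0, z n)"
      by (simp add: z_def algebra_simps)
    have jz: "j (z 0, z n) < \<infinity>"
      "real_of_ereal (j (z 0, z n)) - real_of_ereal (j (x 0, x n)) \<le> s * \<Delta>"
      using j_segment [OF jx jy s] unfolding eq \<Delta>_def by (auto simp: algebra_simps)
    have "\<forall>i<n. norm (slope \<tau> z i) \<le> a" using elim by (auto simp: sz less_imp_le)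
    then have "energy \<Phi> n \<tau> f b x + real_of_ereal (j (x 0, x n))
        \<le> energy \<Phi> n \<tau> f b z + real_of_ereal (j (z 0, z n))"
      using min jz unfolding minimiser_def by blast
    then have "0 \<le> (energy \<Phi> n \<tau> f b z - energy \<Phi> n \<tau> f b x) + s * \<Delta>"
      using jz by linarith
    also have "energy \<Phi> n \<tau> f b z - energy \<Phi> n \<tau> f b x = s * Q s"
      unfolding energy_def Q_def sum_subtractf [symmetric] sum_distrib_left
      by (rule sum.cong [OF refl])
        (use s in \<open>simp add: sz z_def d_def [symmetric] field_simps inner_add_right\<close>)
    finally have "0 \<le> s * (Q s + \<Delta>)" by (simp add: algebra_simps)
    then show ?case using s by (simp add: zero_le_mult_iff)
  qed
  then have "0 \<le> (\<Sum>i<n. \<tau> * (\<phi> (d i) \<bullet> e i + b i \<bullet> e i) - \<tau> * (g i (x i) \<bullet> y i)) + \<Delta>"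
    by (intro tendsto_lowerbound [OF lim]) auto
  then show ?thesis by (simp add: d_def e_def \<Delta>_def inner_add_left)
qed

text \<open>Three kinds of variation are used: constant ones give zero total force, bumps at one
  inner node give the discrete equation, and variations that are constant except at the last node
  give the subdifferential condition.\<close>

lemma discrete_solution:
  assumes tau: "0 < \<tau>" and n: "0 < n"
    and grad: "\<And>i u. i < n \<Longrightarrow> GDERIV (f i) u :> g i u"
    and periods: "\<And>c. \<exists>l. norm (c + l) \<le> B \<and> (\<forall>i<n. \<forall>u. f i (u + l) = f i u)"
  obtains x q where "norm (x 0) \<le> B"
    and "\<And>i. i < n \<Longrightarrow> norm (slope \<tau> x i) < a"
    and "\<And>i. i < n \<Longrightarrow> \<phi> (slope \<tau> x i) = q - b i - \<tau> *\<^sub>R (\<Sum>k\<le>i. g k (x k))"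
    and "(\<Sum>k<n. g k (x k)) = 0"
    and "(q, - q) \<in> subdifferential j (x 0, x n)"
proof -
  obtain x where min: "minimiser n \<tau> f b x" and x0: "norm (x 0) \<le> B"
    using minimiser_exists [OF tau GDERIV_isCont [OF grad] periods] by blast
  define p where "p i = \<phi> (slope \<tau> x i) + b i" for i
  define S where "S = (\<Sum>k<n. g k (x k))"
  have jx: "j (x 0, x n) < \<infinity>" using min by (simp add: minimiser_def)
  have var: "0 \<le> (\<Sum>i<n. p i \<bullet> (y (Suc i) - y i) - \<tau> * (g i (x i) \<bullet> y i))
      + (real_of_ereal (j (x 0 + y 0, x n + y n)) - real_of_ereal (j (x 0, x n)))"
    if "j (x 0 + y 0, x n + y n) < \<infinity>" for y
  proof -
    have "\<tau> * (p i \<bullet> slope \<tau> y i) = p i \<bullet> (y (Suc i) - y i)" for i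
      using tau by (simp add: slope_def)
    then show ?thesis
      using minimiser_variation [OF tau grad min that] by (simp add: p_def)
  qed
  have "S = 0"
  proof -
    \<comment> \<open>A constant variation changes neither the slopes nor \<open>j\<close>, so only
      the force term remains.\<close>
    have "0 \<le> (\<Sum>i<n. - (\<tau> * (g i (x i) \<bullet> S)))"
      using var [of "\<lambda>_. S"] jx by (simp add: j_diag)
    also have "\<dots> = - (\<tau> * (S \<bullet> S))"
      by (simp add: S_def inner_sum_left sum_negf sum_distrib_left)
    finally have "S \<bullet> S \<le> 0" using tau by (simp add: mult_le_0_iff)
    then show ?thesis by (metis inner_eq_zero_iff inner_ge_zero order_antisym)
  qed
  have p_step: "p m = p (Suc m) + \<tau> *\<^sub>R g (Suc m) (x (Suc m))" if m: "Suc m < n" for m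
  proof -
    \<comment> \<open>\<open>c\<close> is the defect of the discrete equation at node
      \<open>Suc m\<close>. Used as a bump there, it leaves the end points fixed and changes only
      the slopes on cells \<open>m\<close> and \<open>Suc m\<close>, so the variation equals
      -|c|^2.\<close>
    define c where "c = p (Suc m) + \<tau> *\<^sub>R g (Suc m) (x (Suc m)) - p m"
    define y where "y i = (if i = Suc m then c else 0)" for i
    have y0n: "y 0 = 0" "y n = 0" using m by (auto simp: y_def)
    have "0 \<le> (\<Sum>i<n. p i \<bullet> (y (Suc i) - y i) - \<tau> * (g i (x i) \<bullet> y i))"
      using var [of y] jx by (simp add: y0n)
    also have "\<dots> = (\<Sum>i\<in>{m, Suc m}. p i \<bullet> (y (Suc i) - y i) - \<tau> * (g i (x i) \<bullet> y i))"
      using m by (intro sum.mono_neutral_right) (auto simp: y_def)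
    also have "\<dots> = - (c \<bullet> c)"
      by (simp add: y_def c_def algebra_simps)
    finally have "c \<bullet> c \<le> 0" by simp
    then have "c = 0" by (metis inner_eq_zero_iff inner_ge_zero order_antisym)
    then show ?thesis by (simp add: c_def)
  qed
  \<comment> \<open>On the last cell the accumulated force is the total force, which is zero;
    descending induction then recovers the other cells.\<close>
  define q where "q = p (n - 1)"
  have q_eq: "p i + \<tau> *\<^sub>R (\<Sum>k\<le>i. g k (x k)) = q" if "i \<le> n - 1" for i
    using that
  proof (induction rule: inc_induct)
    case base
    have "{..n - 1} = {..<n}" using n by auto
    then show ?case using \<open>S = 0\<close> by (simp add: q_def S_def)
  next
    case (step m)
    then show ?case using p_step [of m] by (simp add: algebra_simps)
  qed
  have "(q, - q) \<in> subdifferential j (x 0, x n)"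
    unfolding subdifferential_def
  proof (intro CollectI allI)
    fix \<xi> :: "'a \<times> 'a"
    obtain \<xi>0 \<xi>1 where \<xi>: "\<xi> = (\<xi>0, \<xi>1)" by (cases \<xi>)
    show "j (x 0, x n) + ereal ((q, - q) \<bullet> (\<xi> - (x 0, x n))) \<le> j \<xi>"
    proof (cases "j \<xi> < \<infinity>")
      case True
      \<comment> \<open>Only the last cell is stretched, so the slope terms reduce to
        \<open>q\<close>; the force terms reduce to \<open>S\<close>, which vanishes.\<close>
      define y where "y i = (if i = n then \<xi>1 - x n else \<xi>0 - x 0)" for i
      have yy: "x 0 + y 0 = \<xi>0" "x n + y n = \<xi>1" using n by (auto simp: y_def)
      have "0 \<le> (\<Sum>i<n. p i \<bullet> (y (Suc i) - y i) - \<tau> * (g i (x i) \<bullet> y i))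
          + (real_of_ereal (j \<xi>) - real_of_ereal (j (x 0, x n)))"
        using var [of y] True by (simp add: yy \<xi>)
      also have "(\<Sum>i<n. p i \<bullet> (y (Suc i) - y i) - \<tau> * (g i (x i) \<bullet> y i))
          = (\<Sum>i<n. p i \<bullet> (y (Suc i) - y i)) - \<tau> * (\<Sum>i<n. g i (x i) \<bullet> y i)"
        by (simp add: sum_subtractf sum_distrib_left)
      also have "(\<Sum>i<n. g i (x i) \<bullet> y i) = S \<bullet> (\<xi>0 - x 0)"
        unfolding S_def inner_sum_left by (rule sum.cong) (auto simp: y_def)
      also have "(\<Sum>i<n. p i \<bullet> (y (Suc i) - y i)) = (\<Sum>i\<in>{n - 1}. p i \<bullet> (y (Suc i) - y i))"
        using n by (intro sum.mono_neutral_right) (auto simp: y_def)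
      also have "\<dots> = q \<bullet> ((\<xi>1 - x n) - (\<xi>0 - x 0))"
        using n by (simp add: q_def y_def)
      finally have "real_of_ereal (j (x 0, x n)) + (q, - q) \<bullet> (\<xi> - (x 0, x n)) \<le> real_of_ereal (j \<xi>)"
        by (simp add: \<open>S = 0\<close> \<xi> algebra_simps)
      then show ?thesis
        by (subst ereal_j [OF jx], subst ereal_j [OF True]) simp
    qed auto
  qed
  moreover have "\<phi> (slope \<tau> x i) = q - b i - \<tau> *\<^sub>R (\<Sum>k\<le>i. g k (x k))" if "i < n" for i
    using q_eq [of i] that by (simp add: p_def algebra_simps)
  moreover have "norm (slope \<tau> x i) < a" if "i < n" for i
    by (rule minimiser_interior [OF tau grad min that])
  ultimately show ?thesis
    using that [of x q] x0 \<open>S = 0\<close> by (simp add: S_def)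
qed

end

section \<open>Polygons and Riemann sums\<close>

text \<open>For fixed \<open>\<xi>\<close> the subgradient inequality bounds \<open>j (z n)\<close>
  by a convergent sequence, possibly with value infinity, and lower semicontinuity passes it to the
  limit.\<close>

lemma subdifferential_closed:
  fixes j :: "'a::real_inner \<Rightarrow> ereal"
  assumes lsc: "lower_semicontinuous j"
    and sub: "\<And>n. \<zeta> n \<in> subdifferential j (z n)"
    and lim: "\<zeta> \<longlonglongrightarrow> \<zeta>'" "z \<longlonglongrightarrow> z'"
  shows "\<zeta>' \<in> subdifferential j z'"
  unfolding subdifferential_def
proof (intro CollectI allI)
  fix \<xi>
  have "j z' \<le> j \<xi> - ereal (\<zeta>' \<bullet> (\<xi> - z'))"
  proof (rule lower_semicontinuous_limit_le [OF lsc lim(2)])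
    show "j (z n) \<le> j \<xi> - ereal (\<zeta> n \<bullet> (\<xi> - z n))" for n
      using sub [of n] unfolding subdifferential_def by (auto simp: ereal_le_minus)
    show "(\<lambda>n. j \<xi> - ereal (\<zeta> n \<bullet> (\<xi> - z n))) \<longlonglongrightarrow> j \<xi> - ereal (\<zeta>' \<bullet> (\<xi> - z'))"
      by (intro tendsto_diff_ereal_general tendsto_ereal tendsto_intros lim) auto
  qed
  then show "j z' + ereal (\<zeta>' \<bullet> (\<xi> - z')) \<le> j \<xi>"
    by (simp add: ereal_le_minus)
qed

text \<open>The value at \<open>t \<ge> 0\<close> of the polygon starting at \<open>0\<close> with slope \<open>d i\<close> on the \<open>i\<close>-th grid cell;
  this form makes the Lipschitz bound a telescoping sum.\<close>
definition ramp_sum :: "real \<Rightarrow> nat \<Rightarrow> (nat \<Rightarrow> 'a::real_vector) \<Rightarrow> real \<Rightarrow> 'a"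
  where "ramp_sum \<tau> n d t = (\<Sum>i<n. (min t (real (Suc i) * \<tau>) - min t (real i * \<tau>)) *\<^sub>R d i)"

lemma ramp_telescope:
  assumes "0 \<le> \<tau>" "0 \<le> t"
  shows "(\<Sum>i<n. min t (real (Suc i) * \<tau>) - min t (real i * \<tau>)) = min t (real n * \<tau>)"
  using assms by (subst sum_lessThan_telescope) auto

lemma ramp_sum_lipschitz_aux:
  fixes d :: "nat \<Rightarrow> 'a::real_normed_vector"
  assumes tau: "0 \<le> \<tau>" and d: "\<And>i. i < n \<Longrightarrow> norm (d i) \<le> a" and a: "0 \<le> a"
    and s: "0 \<le> s" "s \<le> t"
  shows "norm (ramp_sum \<tau> n d t - ramp_sum \<tau> n d s) \<le> a * (t - s)"
proof -
  define c where "c t i = min t (real (Suc i) * \<tau>) - min t (real i * \<tau>)" for t i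
  \<comment> \<open>The difference of the two coefficients is the length of the part of cell
    \<open>i\<close> between \<open>s\<close> and \<open>t\<close>.\<close>
  have mono: "c s i \<le> c t i" for i
  proof -
    have "real i * \<tau> \<le> real (Suc i) * \<tau>" using tau by (intro mult_right_mono) auto
    then show ?thesis using s by (auto simp: c_def min_def)
  qed
  have "norm (ramp_sum \<tau> n d t - ramp_sum \<tau> n d s) = norm (\<Sum>i<n. (c t i - c s i) *\<^sub>R d i)"
    by (simp add: ramp_sum_def c_def scaleR_left_diff_distrib sum_subtractf)
  also have "\<dots> \<le> (\<Sum>i<n. (c t i - c s i) * a)"
    using mono d by (intro sum_norm_le) (auto intro: mult_left_mono)
  also have "\<dots> = (min t (real n * \<tau>) - min s (real n * \<tau>)) * a"
    using ramp_telescope [OF tau, of t n] ramp_telescope [OF tau, of s n] s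
    by (simp add: c_def sum_subtractf flip: sum_distrib_right)
  also have "\<dots> \<le> (t - s) * a"
    using s a by (intro mult_right_mono) auto
  finally show ?thesis by (simp add: mult.commute)
qed

lemma ramp_sum_lipschitz:
  fixes d :: "nat \<Rightarrow> 'a::real_normed_vector"
  assumes "0 \<le> \<tau>" "\<And>i. i < n \<Longrightarrow> norm (d i) \<le> a" "0 \<le> a" "0 \<le> s" "0 \<le> t"
  shows "norm (ramp_sum \<tau> n d t - ramp_sum \<tau> n d s) \<le> a * \<bar>t - s\<bar>"
proof (cases "s \<le> t")
  case True
  then show ?thesis using ramp_sum_lipschitz_aux [of \<tau> n d a s t] assms by simp
next
  case False
  then show ?thesis using ramp_sum_lipschitz_aux [of \<tau> n d a t s] assms
    by (simp add: norm_minus_commute)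
qed

lemma ramp_sum_0: "0 \<le> \<tau> \<Longrightarrow> ramp_sum \<tau> n d 0 = 0"
  by (simp add: ramp_sum_def)

lemma ramp_sum_node:
  assumes tau: "0 < \<tau>" and k: "k \<le> n"
  shows "ramp_sum \<tau> n d (real k * \<tau>) = (\<Sum>i<k. \<tau> *\<^sub>R d i)"
proof -
  have c: "min (real k * \<tau>) (real (Suc i) * \<tau>) - min (real k * \<tau>) (real i * \<tau>)
      = (if i < k then \<tau> else 0)" for i
  proof (cases "i < k")
    case True
    then have "real (Suc i) * \<tau> \<le> real k * \<tau>" "real i * \<tau> \<le> real k * \<tau>"
      using tau by (auto intro!: mult_right_mono)
    then show ?thesis using True by (simp add: min_def algebra_simps)
  next
    case False
    then have "real k * \<tau> \<le> real (Suc i) * \<tau>" "real k * \<tau> \<le> real i * \<tau>"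
      using tau by (auto intro!: mult_right_mono)
    then show ?thesis using False by (simp add: min_def)
  qed
  have "ramp_sum \<tau> n d (real k * \<tau>) = (\<Sum>i<n. if i < k then \<tau> *\<^sub>R d i else 0)"
    unfolding ramp_sum_def c by (intro sum.cong) auto
  also have "\<dots> = (\<Sum>i\<in>{..<n} \<inter> {i. i < k}. \<tau> *\<^sub>R d i)"
    by (simp add: sum.inter_restrict)
  also have "{..<n} \<inter> {i. i < k} = {..<k}" using k by auto
  finally show ?thesis .
qed

lemma ramp_sum_slope:
  assumes "0 < \<tau>" "k \<le> n"
  shows "x 0 + ramp_sum \<tau> n (slope \<tau> x) (real k * \<tau>) = x k"
  using assms by (simp add: ramp_sum_node slope_def sum_lessThan_telescope)

text \<open>\<open>ramp_sum\<close> is the integral of the step function with value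
  \<open>d i\<close> on cell \<open>i\<close>; the error is added up cell by cell. Truncating with
  \<open>min\<close> allows \<open>t\<close> anywhere, not only at nodes.\<close>

lemma integral_ramp_sum:
  fixes g :: "real \<Rightarrow> 'a::euclidean_space"
  assumes tau: "0 < \<tau>" and g: "continuous_on {0..real n * \<tau>} g" and t: "0 \<le> t"
    and close: "\<And>i s. i < n \<Longrightarrow> s \<in> {real i * \<tau>..real (Suc i) * \<tau>} \<Longrightarrow> norm (g s - d i) \<le> \<epsilon>"
  shows "norm (integral {0..min t (real n * \<tau>)} g - ramp_sum \<tau> n d t) \<le> \<epsilon> * min t (real n * \<tau>)"
  using g close
proof (induction n)
  case 0
  then show ?case using t by (simp add: ramp_sum_def)
next
  case (Suc n)
  \<comment> \<open>The part of the last cell below \<open>t\<close> is [l, r]; it degenerates to a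
    point when \<open>t\<close> does not reach that cell.\<close>
  define l r where "l = min t (real n * \<tau>)" and "r = min t (real (Suc n) * \<tau>)"
  have le: "real n * \<tau> \<le> real (Suc n) * \<tau>" using tau by (intro mult_right_mono) auto
  have lr: "0 \<le> l" "l \<le> r" "r \<le> real (Suc n) * \<tau>"
    using t tau min.mono [OF order_refl le] by (auto simp: l_def r_def)
  have IH: "norm (integral {0..l} g - ramp_sum \<tau> n d t) \<le> \<epsilon> * l"
    unfolding l_def
  proof (rule Suc.IH)
    show "continuous_on {0..real n * \<tau>} g"
      using Suc.prems(1) by (rule continuous_on_subset) (use le in auto)
  qed (use Suc.prems(2) in auto)
  have g0: "g integrable_on {0..r}" and gl: "g integrable_on {l..r}"
    using lr by (auto intro!: integrable_continuous_real continuous_on_subset [OF Suc.prems(1)])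
  have split: "integral {0..r} g = integral {0..l} g + integral {l..r} g"
    using lr g0 by (simp add: Henstock_Kurzweil_Integration.integral_combine)
  have "norm (integral {l..r} g - (r - l) *\<^sub>R d n) \<le> \<epsilon> * (r - l)"
  proof (cases "l = r")
    case False
    have "integral {l..r} g - (r - l) *\<^sub>R d n = integral {l..r} (\<lambda>s. g s - d n)"
      using lr gl by (subst integral_diff) auto
    moreover have "norm (integral {l..r} (\<lambda>s. g s - d n)) \<le> \<epsilon> * (r - l)"
    proof (rule integral_bound)
      show "continuous_on {l..r} (\<lambda>s. g s - d n)"
        using lr by (intro continuous_intros continuous_on_subset [OF Suc.prems(1)]) auto
      \<comment> \<open>If l < r then \<open>t\<close> lies beyond the left node of the cell, so
        \<open>l\<close> is that node and the closeness hypothesis covers [l, r].\<close>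
      have "real n * \<tau> \<le> l" using False lr unfolding l_def r_def by (auto simp: min_def split: if_splits)
      then show "norm (g s - d n) \<le> \<epsilon>" if "s \<in> {l..r}" for s
        using Suc.prems(2) [of n s] that lr by auto
    qed (use lr in auto)
    ultimately show ?thesis by simp
  qed simp
  moreover have ramp: "ramp_sum \<tau> (Suc n) d t = ramp_sum \<tau> n d t + (r - l) *\<^sub>R d n"
    by (simp add: ramp_sum_def l_def r_def)
  moreover have "norm (integral {0..r} g - (ramp_sum \<tau> n d t + (r - l) *\<^sub>R d n))
      \<le> norm (integral {0..l} g - ramp_sum \<tau> n d t) + norm (integral {l..r} g - (r - l) *\<^sub>R d n)"
    unfolding split using norm_triangle_ineq
    by (metis (no_types, lifting) add_diff_add)
  moreover have "\<epsilon> * r = \<epsilon> * l + \<epsilon> * (r - l)" by (simp add: algebra_simps)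
  ultimately show ?case using IH unfolding l_def [symmetric] r_def [symmetric] ramp
    by linarith
qed

text \<open>The subgradient inequality at the origin makes the sum of the q \<bullet> slope
  nonpositive, so some slope e has q \<bullet> e \<le> 0. There \<phi>(e) \<bullet> e \<le> c a,
  coercivity bounds \<phi>(e), and hence \<open>q\<close>, independently of the grid.\<close>

lemma (in singular_potential) multiplier_bound:
  obtains R where "\<And>n \<tau> x q. 0 < \<tau> \<Longrightarrow> 0 < n \<Longrightarrow> (q, - q) \<in> subdifferential j (x 0, x n) \<Longrightarrow>
    (\<And>i. i < n \<Longrightarrow> norm (slope \<tau> x i) < a \<and> norm (\<phi> (slope \<tau> x i) - q) \<le> c) \<Longrightarrow> norm q \<le> R"
proof -
  obtain C where C: "0 \<le> C" "\<And>d. norm d < a \<Longrightarrow> a / 2 * norm (\<phi> d) - C \<le> \<phi> d \<bullet> d"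
    using phi_coercive by blast
  have "norm q \<le> c + (C + c * a) * 2 / a"
    if tau: "0 < \<tau>" and n: "0 < n" and sub: "(q, - q) \<in> subdifferential j (x 0, x n)"
      and d: "\<And>i. i < n \<Longrightarrow> norm (slope \<tau> x i) < a \<and> norm (\<phi> (slope \<tau> x i) - q) \<le> c" for n \<tau> x q
  proof -
    have "j (x 0, x n) + ereal ((q, - q) \<bullet> (0 - (x 0, x n))) \<le> j 0"
      using sub unfolding subdifferential_def by blast
    then have "q \<bullet> (x n - x 0) \<le> 0"
      using j_nonneg [of "(x 0, x n)"] j_0
      by (cases "j (x 0, x n)") (auto simp: zero_prod_def inner_diff_right)
    moreover have "x n - x 0 = (\<Sum>i<n. \<tau> *\<^sub>R slope \<tau> x i)"
      using tau by (simp add: slope_def sum_lessThan_telescope)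
    ultimately have "\<tau> * (\<Sum>i<n. q \<bullet> slope \<tau> x i) \<le> 0"
      by (simp add: inner_sum_right sum_distrib_left)
    then have "(\<Sum>i<n. q \<bullet> slope \<tau> x i) \<le> 0" using tau by (simp add: mult_le_0_iff)
    then obtain i where i: "i < n" "q \<bullet> slope \<tau> x i \<le> 0"
      using n sum_pos [of "{..<n}" "\<lambda>i. q \<bullet> slope \<tau> x i"] by (force simp: not_less)
    define e where "e = slope \<tau> x i"
    have e: "norm e < a" "norm (\<phi> e - q) \<le> c" "q \<bullet> e \<le> 0"
      using d [OF i(1)] i(2) by (auto simp: e_def)
    have "(\<phi> e - q) \<bullet> e \<le> norm (\<phi> e - q) * norm e" by (rule norm_cauchy_schwarz)
    also have "\<dots> \<le> c * a" using e order_trans [OF norm_ge_zero e(2)] by (intro mult_mono) auto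
    finally have "\<phi> e \<bullet> e \<le> c * a" using e(3) by (simp add: inner_diff_left)
    with C(2) [OF e(1)] have "a / 2 * norm (\<phi> e) \<le> C + c * a" by linarith
    then have "norm (\<phi> e) \<le> (C + c * a) * 2 / a" using a_pos by (simp add: field_simps)
    moreover have "norm q \<le> norm (\<phi> e) + norm (\<phi> e - q)"
      using norm_triangle_sub [of q "\<phi> e"] by (simp add: norm_minus_commute)
    ultimately show ?thesis using e(2) by linarith
  qed
  then show ?thesis using that by blast
qed

section \<open>Uniform bounds and passage to the limit\<close>

locale periodic_bvp = singular_potential a \<phi> \<psi> \<Phi> j
  for a :: real and \<phi> \<psi> :: "'a::euclidean_space \<Rightarrow> 'a" and \<Phi> :: "'a \<Rightarrow> real"
    and j :: "'a \<times> 'a \<Rightarrow> ereal" +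
  fixes T B :: real and F :: "real \<Rightarrow> 'a \<Rightarrow> real" and G :: "real \<Rightarrow> 'a \<Rightarrow> 'a" and h :: "real \<Rightarrow> 'a"
  assumes T_pos: "0 < T"
    and F_grad: "\<And>t u. t \<in> {0..T} \<Longrightarrow> GDERIV (F t) u :> G t u"
    and G_cont: "continuous_on ({0..T} \<times> UNIV) (\<lambda>(t, u). G t u)"
    and periods: "\<And>c. \<exists>l. norm (c + l) \<le> B \<and> (\<forall>t\<in>{0..T}. \<forall>u. F t (u + l) = F t u)"
    and h_cont: "continuous_on {0..T} h"
    and h_mean: "integral {0..T} h = 0"
begin

section \<open>Discrete solutions, bounds independent of the grid, and compactness\<close>

definition H :: "real \<Rightarrow> 'a"
  where "H t = integral {0..t} h"

lemma H_cont: "continuous_on {0..T} H"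
  unfolding H_def using h_cont by (intro indefinite_integral_continuous_1 integrable_continuous_real)

text \<open>The equation for the slopes is the system integrated once. The constant \<open>q\<close>
  stands for the common value of \<phi>(u') at 0 and T, whence the pair
  \<open>(q, - q)\<close>.\<close>

definition discrete_sol :: "nat \<Rightarrow> real \<Rightarrow> (nat \<Rightarrow> 'a) \<Rightarrow> 'a \<Rightarrow> bool"
  where "discrete_sol n \<tau> x q \<longleftrightarrow> 0 < n \<and> 0 < \<tau> \<and> real n * \<tau> = T \<and> norm (x 0) \<le> B \<and>
    (\<forall>i<n. norm (slope \<tau> x i) < a \<and>
      \<phi> (slope \<tau> x i) = q - H (real i * \<tau>) - \<tau> *\<^sub>R (\<Sum>k\<le>i. G (real k * \<tau>) (x k))) \<and>
    (\<Sum>k<n. G (real k * \<tau>) (x k)) = 0 \<and>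
    (q, - q) \<in> subdifferential j (x 0, x n)"

lemma node_in: "discrete_sol n \<tau> x q \<Longrightarrow> i \<le> n \<Longrightarrow> real i * \<tau> \<in> {0..T}"
  unfolding discrete_sol_def by (auto intro: mult_right_mono)

lemma discrete_sol_exists:
  assumes n: "0 < n"
  shows "\<exists>x q. discrete_sol n (T / real n) x q"
proof -
  define \<tau> where "\<tau> = T / real n"
  have tau: "0 < \<tau>" "real n * \<tau> = T" using n T_pos by (auto simp: \<tau>_def)
  have node: "real i * \<tau> \<in> {0..T}" if "i < n" for i
    using that tau by (auto simp flip: tau(2) intro: mult_right_mono)
  obtain x q where "norm (x 0) \<le> B" "\<And>i. i < n \<Longrightarrow> norm (slope \<tau> x i) < a"
    "\<And>i. i < n \<Longrightarrow> \<phi> (slope \<tau> x i) = q - H (real i * \<tau>) - \<tau> *\<^sub>R (\<Sum>k\<le>i. G (real k * \<tau>) (x k))"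
    "(\<Sum>k<n. G (real k * \<tau>) (x k)) = 0" "(q, - q) \<in> subdifferential j (x 0, x n)"
  proof (rule discrete_solution [OF tau(1) n, where f = "\<lambda>i. F (real i * \<tau>)" and
        g = "\<lambda>i. G (real i * \<tau>)" and B = B and b = "\<lambda>i. H (real i * \<tau>)"])
    show "GDERIV (F (real i * \<tau>)) u :> G (real i * \<tau>) u" if "i < n" for i u
      by (rule F_grad [OF node [OF that]])
    show "\<exists>l. norm (c + l) \<le> B \<and> (\<forall>i<n. \<forall>u. F (real i * \<tau>) (u + l) = F (real i * \<tau>) u)" for c
      using periods [of c] node by blast
  qed blast
  then have "discrete_sol n \<tau> x q" using n tau by (simp add: discrete_sol_def)
  then show ?thesis unfolding \<tau>_def by blast
qed

lemma ramp_lipschitz: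
  assumes "discrete_sol n \<tau> x q" and "s \<in> {0..T}" "t \<in> {0..T}"
  shows "norm (ramp_sum \<tau> n (slope \<tau> x) t - ramp_sum \<tau> n (slope \<tau> x) s) \<le> a * \<bar>t - s\<bar>"
  using assms a_pos by (intro ramp_sum_lipschitz) (auto simp: discrete_sol_def less_imp_le)

lemma ramp_norm_le:
  assumes "discrete_sol n \<tau> x q" and "t \<in> {0..T}"
  shows "norm (x 0 + ramp_sum \<tau> n (slope \<tau> x) t) \<le> B + a * T"
proof -
  have d: "0 < \<tau>" "norm (x 0) \<le> B"
    using assms(1) by (auto simp: discrete_sol_def)
  have "norm (ramp_sum \<tau> n (slope \<tau> x) t - ramp_sum \<tau> n (slope \<tau> x) 0) \<le> a * \<bar>t - 0\<bar>"
    using T_pos by (intro ramp_lipschitz [OF assms(1) _ assms(2)]) auto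
  also have "\<dots> \<le> a * T" using a_pos assms(2) by (intro mult_left_mono) auto
  finally show ?thesis
    using d norm_triangle_ineq [of "x 0" "ramp_sum \<tau> n (slope \<tau> x) t"] by (simp add: ramp_sum_0)
qed

lemma discrete_norm_le:
  assumes "discrete_sol n \<tau> x q" and "i \<le> n"
  shows "norm (x i) \<le> B + a * T"
  using ramp_norm_le [OF assms(1) node_in [OF assms]] ramp_sum_slope [of \<tau> i n x] assms
  by (simp add: discrete_sol_def)

lemma force_bound:
  obtains M where "0 \<le> M"
    "\<And>t v. t \<in> {0..T} \<Longrightarrow> norm v \<le> B + a * T \<Longrightarrow> norm (G t v) \<le> M"
proof -
  have "continuous_on ({0..T} \<times> cball 0 (B + a * T)) (\<lambda>(t, v). G t v)"
    by (rule continuous_on_subset [OF G_cont]) auto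
  then have "compact ((\<lambda>(t, v). G t v) ` ({0..T} \<times> cball 0 (B + a * T)))"
    by (rule compact_continuous_image) (intro compact_Times compact_Icc compact_cball)
  then have "bounded ((\<lambda>(t, v). G t v) ` ({0..T} \<times> cball 0 (B + a * T)))"
    by (rule compact_imp_bounded)
  then obtain M where "0 < M" "\<forall>p\<in>(\<lambda>(t, v). G t v) ` ({0..T} \<times> cball 0 (B + a * T)). norm p \<le> M"
    unfolding bounded_pos by blast
  then show ?thesis using that [of M] by force
qed

lemma discrete_force_sum_le:
  assumes M: "0 \<le> M" "\<And>t v. t \<in> {0..T} \<Longrightarrow> norm v \<le> B + a * T \<Longrightarrow> norm (G t v) \<le> M"
    and d: "discrete_sol n \<tau> x q" and i: "i < n"
  shows "norm (\<tau> *\<^sub>R (\<Sum>k\<le>i. G (real k * \<tau>) (x k))) \<le> T * M"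
proof -
  have tau: "0 < \<tau>" "real n * \<tau> = T" using d by (auto simp: discrete_sol_def)
  have "norm (\<Sum>k\<le>i. G (real k * \<tau>) (x k)) \<le> (\<Sum>k\<le>i. M)"
    using i by (intro sum_norm_le M node_in [OF d] discrete_norm_le [OF d]) auto
  also have "\<dots> \<le> real n * M" using i M(1) by (auto intro!: mult_right_mono)
  finally have "\<tau> * norm (\<Sum>k\<le>i. G (real k * \<tau>) (x k)) \<le> \<tau> * (real n * M)"
    using tau by (intro mult_left_mono) auto
  also have "\<dots> = T * M" by (simp add: mult.left_commute flip: tau(2))
  finally show ?thesis using tau by simp
qed

text \<open>The difference is minus the sum of \<open>H\<close> and the accumulated force; the
  latter is bounded since the nodes of all grids lie in one ball.\<close>

lemma momentum_bound:
  obtains c where "\<And>n \<tau> x q i. discrete_sol n \<tau> x q \<Longrightarrow> i < n \<Longrightarrow> norm (\<phi> (slope \<tau> x i) - q) \<le> c"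
proof -
  obtain M where M: "0 \<le> M" "\<And>t v. t \<in> {0..T} \<Longrightarrow> norm v \<le> B + a * T \<Longrightarrow> norm (G t v) \<le> M"
    using force_bound by blast
  have "bounded (H ` {0..T})"
    by (intro compact_imp_bounded compact_continuous_image H_cont compact_Icc)
  then obtain c where "\<forall>p\<in>H ` {0..T}. norm p \<le> c" unfolding bounded_iff by blast
  then have c: "norm (H t) \<le> c" if "t \<in> {0..T}" for t using that by blast
  have "norm (\<phi> (slope \<tau> x i) - q) \<le> c + T * M" if d: "discrete_sol n \<tau> x q" and i: "i < n" for n \<tau> x q i
  proof -
    have "\<phi> (slope \<tau> x i) - q = - (H (real i * \<tau>) + \<tau> *\<^sub>R (\<Sum>k\<le>i. G (real k * \<tau>) (x k)))"
      using d i by (simp add: discrete_sol_def)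
    then show ?thesis
      using norm_triangle_mono [OF c discrete_force_sum_le [OF M d i]] node_in [OF d] i
      by (simp only: norm_minus_cancel)
  qed
  then show ?thesis using that by blast
qed

lemma multiplier_bounded:
  obtains R where "\<And>n \<tau> x q. discrete_sol n \<tau> x q \<Longrightarrow> norm q \<le> R"
proof -
  obtain c where c: "\<And>n \<tau> x q i. discrete_sol n \<tau> x q \<Longrightarrow> i < n \<Longrightarrow> norm (\<phi> (slope \<tau> x i) - q) \<le> c"
    using momentum_bound by blast
  obtain R where R: "\<And>n \<tau> x q. 0 < \<tau> \<Longrightarrow> 0 < n \<Longrightarrow> (q, - q) \<in> subdifferential j (x 0, x n) \<Longrightarrow>
    (\<And>i. i < n \<Longrightarrow> norm (slope \<tau> x i) < a \<and> norm (\<phi> (slope \<tau> x i) - q) \<le> c) \<Longrightarrow> norm q \<le> R"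
    using multiplier_bound by blast
  have "norm q \<le> R" if d: "discrete_sol n \<tau> x q" for n \<tau> x q
    by (rule R [where \<tau> = \<tau> and n = n and x = x]) (use d c [OF d] in \<open>auto simp: discrete_sol_def\<close>)
  then show ?thesis using that by blast
qed

text \<open>Arzela-Ascoli is applied to the pairs of polygon and constant \<open>q N\<close>, so
  that one subsequence serves both. The second component does not depend on t, hence leaves the
  equicontinuity estimate unchanged.\<close>

lemma convergent_discrete_sols:
  obtains n \<tau> x q p u where "\<And>N. discrete_sol (n N) (\<tau> N) (x N) (q N)"
    and "\<tau> \<longlonglongrightarrow> 0" and "q \<longlonglongrightarrow> p" and "continuous_on {0..T} u"
    and "uniform_limit {0..T} (\<lambda>N t. x N 0 + ramp_sum (\<tau> N) (n N) (slope (\<tau> N) (x N)) t) u sequentially"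
proof -
  have "\<forall>N. \<exists>x q. discrete_sol (Suc N) (T / real (Suc N)) x q"
    using discrete_sol_exists by blast
  then obtain x q where d: "\<And>N. discrete_sol (Suc N) (T / real (Suc N)) (x N) (q N)"
    by metis
  define \<tau> where "\<tau> N = T / real (Suc N)" for N
  define U where "U N t = x N 0 + ramp_sum (\<tau> N) (Suc N) (slope (\<tau> N) (x N)) t" for N t
  have d: "discrete_sol (Suc N) (\<tau> N) (x N) (q N)" for N
    using d by (simp add: \<tau>_def)
  obtain R where R: "\<And>n \<tau> x q. discrete_sol n \<tau> x q \<Longrightarrow> norm q \<le> R"
    using multiplier_bounded by blast
  have lip: "norm (U N t - U N s) \<le> a * \<bar>t - s\<bar>" if "s \<in> {0..T}" "t \<in> {0..T}" for N s t
    using ramp_lipschitz [OF d that] by (simp add: U_def)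
  obtain g k where g: "continuous_on {0..T} g" and k: "strict_mono (k :: nat \<Rightarrow> nat)"
    and lim: "\<And>e. 0 < e \<Longrightarrow>
      \<exists>N0. \<forall>N t. N \<ge> N0 \<and> t \<in> {0..T} \<longrightarrow> norm ((U (k N) t, q (k N)) - g t) < e"
  proof (rule Arzela_Ascoli [where \<F> = "\<lambda>N t. (U N t, q N)" and S = "{0..T}" and M = "(B + a * T) + R"])
    show "norm (U N t, q N) \<le> (B + a * T) + R" if "t \<in> {0..T}" for N t
      using norm_Pair_le [of "U N t" "q N"] ramp_norm_le [OF d that, of N] R [OF d, of N]
      by (simp add: U_def)
    show "\<exists>r>0. \<forall>N s. s \<in> {0..T} \<and> norm (t - s) < r \<longrightarrow> norm ((U N t, q N) - (U N s, q N)) < e"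
      if t: "t \<in> {0..T}" and e: "0 < e" for t e
    proof (intro exI conjI allI impI)
      show "0 < e / a" using e a_pos by simp
      fix N s assume s: "s \<in> {0..T} \<and> norm (t - s) < e / a"
      then have "a * \<bar>t - s\<bar> < e" using a_pos by (simp add: pos_less_divide_eq mult.commute)
      with lip [of s t N] s t show "norm ((U N t, q N) - (U N s, q N)) < e" by simp
    qed
  qed (use that in auto)
  have ul: "uniform_limit {0..T} (\<lambda>N t. (U (k N) t, q (k N))) g sequentially"
    unfolding uniform_limit_sequentially_iff dist_norm using lim by blast
  have u: "uniform_limit {0..T} (\<lambda>N. U (k N)) (\<lambda>t. fst (g t)) sequentially"
    using bounded_linear.uniform_limit [OF bounded_linear_fst ul] by simp
  have "(\<lambda>N. (U (k N) 0, q (k N))) \<longlonglongrightarrow> g 0"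
    by (rule tendsto_uniform_limitI [OF ul]) (use T_pos in simp)
  then have "(\<lambda>N. q (k N)) \<longlonglongrightarrow> snd (g 0)"
    using tendsto_snd by fastforce
  moreover have "(\<lambda>N. \<tau> (k N)) \<longlonglongrightarrow> 0"
  proof -
    have "\<tau> \<longlonglongrightarrow> 0" unfolding \<tau>_def
      using tendsto_mult [OF tendsto_const LIMSEQ_inverse_real_of_nat, of T] by (simp add: divide_inverse)
    then show ?thesis using LIMSEQ_subseq_LIMSEQ [OF _ k] by (simp add: o_def)
  qed
  moreover have "continuous_on {0..T} (\<lambda>t. fst (g t))"
    by (intro continuous_on_fst g)
  ultimately show ?thesis
    using that [of "\<lambda>N. Suc (k N)" "\<lambda>N. \<tau> (k N)" "\<lambda>N. x (k N)" "\<lambda>N. q (k N)"] d u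
    by (simp add: U_def [abs_def])
qed

end

section \<open>The limit of a convergent sequence of discrete solutions\<close>

locale discrete_limit = periodic_bvp +
  fixes n :: "nat \<Rightarrow> nat" and \<tau> :: "nat \<Rightarrow> real" and x :: "nat \<Rightarrow> nat \<Rightarrow> 'a"
    and q :: "nat \<Rightarrow> 'a" and u :: "real \<Rightarrow> 'a" and p :: 'a
  assumes sol: "\<And>N. discrete_sol (n N) (\<tau> N) (x N) (q N)"
    and tau_lim: "\<tau> \<longlonglongrightarrow> 0"
    and q_lim: "q \<longlonglongrightarrow> p"
    and u_cont: "continuous_on {0..T} u"
    and u_lim: "uniform_limit {0..T}
      (\<lambda>N t. x N 0 + ramp_sum (\<tau> N) (n N) (slope (\<tau> N) (x N)) t) u sequentially"
begin

abbreviation cell :: "nat \<Rightarrow> nat \<Rightarrow> real set"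
  where "cell N i \<equiv> {real i * \<tau> N..real (Suc i) * \<tau> N}"

text \<open>Uniform convergence to \<open>g\<close> of the step functions with value
  \<open>D N i\<close> on cell \<open>i\<close>, phrased without choosing values at the
  nodes.\<close>

definition uniformly_near :: "(real \<Rightarrow> 'a) \<Rightarrow> (nat \<Rightarrow> nat \<Rightarrow> 'a) \<Rightarrow> bool"
  where "uniformly_near g D \<longleftrightarrow>
    (\<forall>e>0. \<forall>\<^sub>F N in sequentially. \<forall>i<n N. \<forall>s\<in>cell N i. norm (g s - D N i) \<le> e)"

lemma tau_pos: "0 < \<tau> N" and tau_sum: "real (n N) * \<tau> N = T"
  using sol [of N] by (auto simp: discrete_sol_def)

lemma cell_subset:
  assumes "i < n N" "s \<in> cell N i"
  shows "s \<in> {0..T}" "real i * \<tau> N \<in> {0..T}" "real (Suc i) * \<tau> N \<in> {0..T}"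
    "\<bar>s - real i * \<tau> N\<bar> \<le> \<tau> N" "\<bar>s - real (Suc i) * \<tau> N\<bar> \<le> \<tau> N"
proof -
  show 1: "real i * \<tau> N \<in> {0..T}" "real (Suc i) * \<tau> N \<in> {0..T}"
    using assms(1) node_in [OF sol, of i N] node_in [OF sol, of "Suc i" N] by auto
  then show "s \<in> {0..T}" using assms(2) by auto
  have "real (Suc i) * \<tau> N = real i * \<tau> N + \<tau> N" by (simp add: algebra_simps)
  then show "\<bar>s - real i * \<tau> N\<bar> \<le> \<tau> N" "\<bar>s - real (Suc i) * \<tau> N\<bar> \<le> \<tau> N"
    using assms(2) unfolding atLeastAtMost_iff by linarith+
qed

lemma ramp_sum_tendsto_integral:
  assumes g: "continuous_on {0..T} g" and near: "uniformly_near g D" and t: "t \<in> {0..T}"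
  shows "(\<lambda>N. ramp_sum (\<tau> N) (n N) (D N) t) \<longlonglongrightarrow> integral {0..t} g"
proof (rule metric_LIMSEQ_I, unfold eventually_sequentially [symmetric])
  fix e :: real assume e: "0 < e"
  have "\<forall>\<^sub>F N in sequentially. \<forall>i<n N. \<forall>s\<in>cell N i. norm (g s - D N i) \<le> e / (2 * T)"
    using near e T_pos unfolding uniformly_near_def by simp
  then show "\<forall>\<^sub>F N in sequentially. dist (ramp_sum (\<tau> N) (n N) (D N) t) (integral {0..t} g) < e"
  proof eventually_elim
    case (elim N)
    have "norm (integral {0..min t (real (n N) * \<tau> N)} g - ramp_sum (\<tau> N) (n N) (D N) t)
        \<le> e / (2 * T) * min t (real (n N) * \<tau> N)"
      using elim t g by (intro integral_ramp_sum tau_pos) (auto simp: tau_sum)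
    also have "\<dots> \<le> e / (2 * T) * T"
      using e T_pos by (intro mult_left_mono) (auto simp: tau_sum)
    also have "\<dots> < e" using e T_pos by simp
    finally show ?case using t by (simp add: tau_sum dist_norm norm_minus_commute min_absorb1)
  qed
qed

lemma pointwise_lim:
  "t \<in> {0..T} \<Longrightarrow> (\<lambda>N. x N 0 + ramp_sum (\<tau> N) (n N) (slope (\<tau> N) (x N)) t) \<longlonglongrightarrow> u t"
  by (rule tendsto_uniform_limitI [OF u_lim])

lemma x0_lim: "(\<lambda>N. x N 0) \<longlonglongrightarrow> u 0"
  using pointwise_lim [of 0] T_pos tau_pos by (simp add: ramp_sum_0 less_imp_le)

lemma xn_lim: "(\<lambda>N. x N (n N)) \<longlonglongrightarrow> u T"
proof -
  have "x N 0 + ramp_sum (\<tau> N) (n N) (slope (\<tau> N) (x N)) T = x N (n N)" for N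
    using ramp_sum_slope [OF tau_pos order_refl, of "x N" N "n N"] by (simp add: tau_sum)
  then show ?thesis using pointwise_lim [of T] T_pos by simp
qed

lemma u_bound: "t \<in> {0..T} \<Longrightarrow> norm (u t) \<le> B + a * T"
  by (rule tendsto_upperbound [OF tendsto_norm [OF pointwise_lim]])
    (auto intro!: always_eventually ramp_norm_le sol)

lemma force_cont: "continuous_on {0..T} (\<lambda>t. G t (u t))"
proof -
  have "continuous_on {0..T} (\<lambda>t. (\<lambda>(t, v). G t v) (t, u t))"
    by (intro continuous_on_compose2 [OF G_cont] continuous_intros u_cont) auto
  then show ?thesis by simp
qed

text \<open>Uniform continuity of \<open>G\<close> on a compact set: a point of cell
  \<open>i\<close> is within \<tau> of the node in time, and \<open>u\<close> there is close to the
  polygon, which moves by at most a \<tau> within the cell.\<close>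

lemma force_near: "uniformly_near (\<lambda>t. G t (u t)) (\<lambda>N i. G (real i * \<tau> N) (x N i))"
  unfolding uniformly_near_def
proof (intro allI impI)
  fix e :: real assume e: "0 < e"
  define K where "K = {0..T} \<times> cball (0 :: 'a) (B + a * T)"
  have "uniformly_continuous_on K (\<lambda>(t, v). G t v)"
    unfolding K_def
    by (intro compact_uniformly_continuous continuous_on_subset [OF G_cont] compact_Times) auto
  then obtain \<delta> where \<delta>: "0 < \<delta>" "\<And>P P'. P \<in> K \<Longrightarrow> P' \<in> K \<Longrightarrow> dist P' P < \<delta> \<Longrightarrow>
      dist ((\<lambda>(t, v). G t v) P') ((\<lambda>(t, v). G t v) P) < e"
    unfolding uniformly_continuous_on_def using e by metis
  have "(\<lambda>N. (1 + a) * \<tau> N) \<longlonglongrightarrow> (1 + a) * 0" by (intro tendsto_intros tau_lim)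
  then have ev1: "\<forall>\<^sub>F N in sequentially. (1 + a) * \<tau> N < \<delta> / 2"
    by (rule order_tendstoD) (use \<delta> in simp)
  have ev2: "\<forall>\<^sub>F N in sequentially. \<forall>t\<in>{0..T}.
      dist (x N 0 + ramp_sum (\<tau> N) (n N) (slope (\<tau> N) (x N)) t) (u t) < \<delta> / 2"
    using uniform_limitD [OF u_lim half_gt_zero [OF \<delta>(1)]] .
  show "\<forall>\<^sub>F N in sequentially. \<forall>i<n N. \<forall>s\<in>cell N i.
      norm (G s (u s) - G (real i * \<tau> N) (x N i)) \<le> e"
    using ev1 ev2
  proof eventually_elim
    case (elim N)
    show ?case
    proof (intro allI impI ballI)
      fix i s assume i: "i < n N" and s: "s \<in> cell N i"
      note c = cell_subset [OF i s]
      define U where "U t = x N 0 + ramp_sum (\<tau> N) (n N) (slope (\<tau> N) (x N)) t" for t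
      have Ui: "U (real i * \<tau> N) = x N i"
        using ramp_sum_slope [OF tau_pos, of i "n N" "x N" N] i by (simp add: U_def)
      have "norm (U s - U (real i * \<tau> N)) \<le> a * \<bar>s - real i * \<tau> N\<bar>"
        using ramp_lipschitz [OF sol c(2) c(1)] by (simp add: U_def)
      also have "\<dots> \<le> a * \<tau> N" using c(4) a_pos by (intro mult_left_mono) auto
      finally have "dist (U s) (x N i) \<le> a * \<tau> N" by (simp add: Ui dist_norm)
      moreover have "dist (u s) (U s) < \<delta> / 2"
        using elim(2) c(1) unfolding U_def by (metis dist_commute)
      moreover have "dist (u s) (x N i) \<le> dist (u s) (U s) + dist (U s) (x N i)"
        by (rule dist_triangle)
      moreover have "dist (s, u s) (real i * \<tau> N, x N i) \<le> dist s (real i * \<tau> N) + dist (u s) (x N i)"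
        unfolding dist_Pair_Pair by (rule sqrt_sum_squares_le_sum) auto
      ultimately have "dist (s, u s) (real i * \<tau> N, x N i) < \<delta>"
        using c(4) elim(1) by (simp add: dist_norm algebra_simps)
      moreover have "(s, u s) \<in> K" "(real i * \<tau> N, x N i) \<in> K"
        using c u_bound [OF c(1)] discrete_norm_le [OF sol, of i N] i by (auto simp: K_def)
      ultimately have "dist (G s (u s)) (G (real i * \<tau> N) (x N i)) < e"
        using \<delta>(2) [of "(real i * \<tau> N, x N i)" "(s, u s)"] by simp
      then show "norm (G s (u s) - G (real i * \<tau> N) (x N i)) \<le> e"
        by (simp add: dist_norm)
    qed
  qed
qed

lemma force_mean: "integral {0..T} (\<lambda>t. G t (u t)) = 0"
proof -
  have "(\<lambda>N. ramp_sum (\<tau> N) (n N) (\<lambda>i. G (real i * \<tau> N) (x N i)) T)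
      \<longlonglongrightarrow> integral {0..T} (\<lambda>t. G t (u t))"
    by (rule ramp_sum_tendsto_integral [OF force_cont force_near]) (use T_pos in simp)
  moreover have "ramp_sum (\<tau> N) (n N) (\<lambda>i. G (real i * \<tau> N) (x N i)) T = 0" for N
  proof -
    have "(\<Sum>i<n N. G (real i * \<tau> N) (x N i)) = 0" using sol by (simp add: discrete_sol_def)
    then show ?thesis
      using ramp_sum_node [OF tau_pos order_refl, of N "n N" "\<lambda>i. G (real i * \<tau> N) (x N i)"]
      by (simp add: tau_sum flip: scaleR_sum_right)
  qed
  ultimately show ?thesis using LIMSEQ_unique by (simp add: LIMSEQ_const_iff)
qed

text \<open>The limit momentum: it will turn out to be \<phi>(u').\<close>

definition V :: "real \<Rightarrow> 'a"
  where "V t = p - H t - integral {0..t} (\<lambda>r. G r (u r))"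

lemma V_cont: "continuous_on {0..T} V"
  unfolding V_def
  by (intro continuous_intros H_cont indefinite_integral_continuous_1 integrable_continuous_real force_cont)

text \<open>The error splits into four parts of size at most e/4: convergence of \<open>q\<close>,
  the modulus of continuity of \<open>H\<close>, the Riemann sum of the force, and the integral of
  the force from \<open>s\<close> to the end of the cell.\<close>

lemma momentum_near: "uniformly_near V (\<lambda>N i. \<phi> (slope (\<tau> N) (x N) i))"
  unfolding uniformly_near_def
proof (intro allI impI)
  fix e :: real assume e: "0 < e"
  define g where "g t = G t (u t)" for t
  have g: "continuous_on {0..T} g" using force_cont by (simp add: g_def)
  obtain M where M: "0 \<le> M" "\<And>t v. t \<in> {0..T} \<Longrightarrow> norm v \<le> B + a * T \<Longrightarrow> norm (G t v) \<le> M"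
    using force_bound by blast
  have gM: "norm (g t) \<le> M" if "t \<in> {0..T}" for t
    unfolding g_def by (rule M(2) [OF that u_bound [OF that]])
  have "uniformly_continuous_on {0..T} H"
    by (intro compact_uniformly_continuous H_cont compact_Icc)
  then obtain \<delta> where \<delta>: "0 < \<delta>" "\<And>s t. s \<in> {0..T} \<Longrightarrow> t \<in> {0..T} \<Longrightarrow> dist t s < \<delta> \<Longrightarrow>
      dist (H t) (H s) < e / 4"
    unfolding uniformly_continuous_on_def using e by (metis zero_less_divide_iff zero_less_numeral)
  have "\<forall>\<^sub>F N in sequentially. \<tau> N < \<delta>"
    using order_tendstoD(2) [OF tau_lim \<delta>(1)] .
  moreover have "\<forall>\<^sub>F N in sequentially. M * \<tau> N < e / 4"
  proof (rule order_tendstoD)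
    show "(\<lambda>N. M * \<tau> N) \<longlonglongrightarrow> M * 0" by (intro tendsto_intros tau_lim)
  qed (use e in simp)
  moreover have "\<forall>\<^sub>F N in sequentially. dist (q N) p < e / 4"
    by (rule tendstoD [OF q_lim]) (use e in simp)
  moreover have "\<forall>\<^sub>F N in sequentially. \<forall>i<n N. \<forall>s\<in>cell N i.
      norm (G s (u s) - G (real i * \<tau> N) (x N i)) \<le> e / (4 * T)"
    using force_near e T_pos unfolding uniformly_near_def by simp
  ultimately show "\<forall>\<^sub>F N in sequentially. \<forall>i<n N. \<forall>s\<in>cell N i.
      norm (V s - \<phi> (slope (\<tau> N) (x N) i)) \<le> e"
  proof eventually_elim
    case (elim N)
    show ?case
    proof (intro allI impI ballI)
      fix i s assume i: "i < n N" and s: "s \<in> cell N i"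
      note c = cell_subset [OF i s]
      \<comment> \<open>The sum over k \<le> i covers the cells 0 to \<open>i\<close>, so it
        approximates the integral up to the right end of cell \<open>i\<close>, not up to its left
        node.\<close>
      define r where "r = real (Suc i) * \<tau> N"
      define S where "S = \<tau> N *\<^sub>R (\<Sum>k\<le>i. G (real k * \<tau> N) (x N k))"
      have phi: "\<phi> (slope (\<tau> N) (x N) i) = q N - H (real i * \<tau> N) - S"
        using sol [of N] i by (simp add: discrete_sol_def S_def)
      have r: "r \<in> {0..T}" "s \<le> r" using c(3) s by (auto simp: r_def)
      have "norm (integral {0..min r (real (Suc i) * \<tau> N)} g
          - ramp_sum (\<tau> N) (Suc i) (\<lambda>k. G (real k * \<tau> N) (x N k)) r)
          \<le> e / (4 * T) * min r (real (Suc i) * \<tau> N)"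
      proof (rule integral_ramp_sum [OF tau_pos])
        show "continuous_on {0..real (Suc i) * \<tau> N} g"
          using r(1) unfolding r_def by (intro continuous_on_subset [OF g]) auto
        show "norm (g s - G (real k * \<tau> N) (x N k)) \<le> e / (4 * T)"
          if "k < Suc i" "s \<in> cell N k" for k s
          using elim(4) that i unfolding g_def by auto
      qed (use r in simp)
      also have "\<dots> \<le> e / (4 * T) * T" using r e T_pos by (intro mult_left_mono) (auto simp: r_def)
      also have "\<dots> = e / 4" using T_pos by simp
      also have "ramp_sum (\<tau> N) (Suc i) (\<lambda>k. G (real k * \<tau> N) (x N k)) r = S"
        unfolding r_def S_def by (subst ramp_sum_node [OF tau_pos order_refl])
          (simp add: scaleR_sum_right lessThan_Suc_atMost)
      finally have e1: "norm (integral {0..r} g - S) \<le> e / 4" by (simp add: r_def)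
      have "integral {0..r} g = integral {0..s} g + integral {s..r} g"
        using r c(1) g
        by (intro Henstock_Kurzweil_Integration.integral_combine [symmetric]
            integrable_continuous_real continuous_on_subset [OF g]) auto
      moreover have "norm (integral {s..r} g) \<le> M * (r - s)"
        using r c(1) by (intro integral_bound continuous_on_subset [OF g] gM) auto
      moreover have "M * (r - s) \<le> M * \<tau> N"
        using c(5) M(1) r by (intro mult_left_mono) (auto simp: r_def)
      ultimately have e2: "norm (integral {0..s} g - integral {0..r} g) \<le> e / 4"
        using elim(2) by simp
      have "dist s (real i * \<tau> N) < \<delta>" using c(4) elim(1) by (simp add: dist_real_def)
      then have e3: "norm (H s - H (real i * \<tau> N)) \<le> e / 4"
        using \<delta>(2) [OF c(2) c(1)] by (simp add: dist_norm)
      have e4: "norm (p - q N) \<le> e / 4" using elim(3) by (simp add: dist_norm norm_minus_commute)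
      have "V s - \<phi> (slope (\<tau> N) (x N) i) = (p - q N) - (H s - H (real i * \<tau> N))
          - (integral {0..s} g - integral {0..r} g) - (integral {0..r} g - S)"
        by (simp add: V_def g_def [abs_def] phi)
      then have "norm (V s - \<phi> (slope (\<tau> N) (x N) i)) \<le> norm (p - q N) + norm (H s - H (real i * \<tau> N))
          + norm (integral {0..s} g - integral {0..r} g) + norm (integral {0..r} g - S)"
        by (smt (verit, best) norm_triangle_ineq4)
      then show "norm (V s - \<phi> (slope (\<tau> N) (x N) i)) \<le> e" using e1 e2 e3 e4 by linarith
    qed
  qed
qed

lemma slope_near: "uniformly_near (\<lambda>t. \<psi> (V t)) (\<lambda>N i. slope (\<tau> N) (x N) i)"
  unfolding uniformly_near_def
proof (intro allI impI)
  fix e :: real assume e: "0 < e"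
  have "bounded (V ` {0..T})"
    by (intro compact_imp_bounded compact_continuous_image V_cont compact_Icc)
  then obtain c where "\<forall>v\<in>V ` {0..T}. norm v \<le> c" unfolding bounded_iff by blast
  then have c: "norm (V t) \<le> c" if "t \<in> {0..T}" for t using that by blast
  have "uniformly_continuous_on (cball 0 (c + 1)) \<psi>"
    by (intro compact_uniformly_continuous continuous_on_subset [OF psi_cont]) auto
  then obtain \<delta> where \<delta>: "0 < \<delta>" "\<And>v v'. v \<in> cball 0 (c + 1) \<Longrightarrow> v' \<in> cball 0 (c + 1) \<Longrightarrow>
      dist v' v < \<delta> \<Longrightarrow> dist (\<psi> v') (\<psi> v) < e"
    unfolding uniformly_continuous_on_def using e by metis
  \<comment> \<open>The bound 1 keeps the discrete momenta in the ball of radius c + 1, where \<psi>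
    is uniformly continuous.\<close>
  have "0 < min 1 (\<delta> / 2)" using \<delta> by simp
  then have "\<forall>\<^sub>F N in sequentially. \<forall>i<n N. \<forall>s\<in>cell N i.
      norm (V s - \<phi> (slope (\<tau> N) (x N) i)) \<le> min 1 (\<delta> / 2)"
    using momentum_near unfolding uniformly_near_def by blast
  then show "\<forall>\<^sub>F N in sequentially. \<forall>i<n N. \<forall>s\<in>cell N i.
      norm (\<psi> (V s) - slope (\<tau> N) (x N) i) \<le> e"
  proof eventually_elim
    case (elim N)
    show ?case
    proof (intro allI impI ballI)
      fix i s assume i: "i < n N" and s: "s \<in> cell N i"
      define f where "f = \<phi> (slope (\<tau> N) (x N) i)"
      have near: "norm (V s - f) \<le> 1" "norm (V s - f) \<le> \<delta> / 2"
        using elim i s by (auto simp: f_def)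
      have "norm (V s) \<le> c" using c cell_subset(1) [OF i s] by blast
      moreover have "norm f \<le> norm (V s) + norm (V s - f)"
        using norm_triangle_sub [of f "V s"] by (simp add: norm_minus_commute)
      ultimately have "dist (\<psi> (V s)) (\<psi> f) < e"
        using near \<delta> by (intro \<delta>(2)) (auto simp: dist_norm)
      moreover have "\<psi> f = slope (\<tau> N) (x N) i"
        unfolding f_def using sol [of N] i by (intro psi_phi) (simp add: discrete_sol_def)
      ultimately show "norm (\<psi> (V s) - slope (\<tau> N) (x N) i) \<le> e" by (simp add: dist_norm)
    qed
  qed
qed

lemma velocity_cont: "continuous_on {0..T} (\<lambda>t. \<psi> (V t))"
  by (rule continuous_on_compose2 [OF psi_cont V_cont]) simp

text \<open>The polygons converge to \<open>u\<close>, and as integrals of step functions close to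
  \<open>\<psi> (V t)\<close> they also converge to the right-hand side.\<close>

lemma u_integral:
  assumes "t \<in> {0..T}"
  shows "u t = u 0 + integral {0..t} (\<lambda>s. \<psi> (V s))"
proof -
  have "(\<lambda>N. x N 0 + ramp_sum (\<tau> N) (n N) (slope (\<tau> N) (x N)) t)
      \<longlonglongrightarrow> u 0 + integral {0..t} (\<lambda>s. \<psi> (V s))"
    by (intro tendsto_add x0_lim ramp_sum_tendsto_integral velocity_cont slope_near assms)
  then show ?thesis using pointwise_lim [OF assms] LIMSEQ_unique by blast
qed

text \<open>Here u' = \<psi>(V) stays in the open ball, the range of \<psi>, and \<phi>(u') = V is
  differentiated by the fundamental theorem of calculus. The boundary condition is the limit of the
  discrete ones.\<close>

lemma limit_is_solution: "is_solution T a \<phi> G h j u"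
  unfolding is_solution_def
proof (intro exI conjI ballI)
  let ?u' = "\<lambda>t. \<psi> (V t)" and ?w = "\<lambda>t. - h t - G t (u t)"
  show "has_C1_derivative_on u ?u' {0..T}"
    unfolding has_C1_derivative_on_def
  proof (intro conjI ballI velocity_cont)
    fix t assume t: "t \<in> {0..T}"
    have "((\<lambda>t. u 0 + integral {0..t} ?u') has_vector_derivative 0 + ?u' t) (at t within {0..T})"
      by (intro has_vector_derivative_add has_vector_derivative_const
          integral_has_vector_derivative velocity_cont t)
    then have "((\<lambda>t. u 0 + integral {0..t} ?u') has_vector_derivative ?u' t) (at t within {0..T})"
      by simp
    then show "(u has_vector_derivative ?u' t) (at t within {0..T})"
      by (rule has_vector_derivative_transform [OF t, rotated]) (rule u_integral)
  qed
  show "has_C1_derivative_on (\<lambda>t. \<phi> (?u' t)) ?w {0..T}"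
    unfolding has_C1_derivative_on_def phi_psi
  proof (intro conjI ballI)
    fix t assume t: "t \<in> {0..T}"
    have "((\<lambda>t. p - H t - integral {0..t} (\<lambda>r. G r (u r))) has_vector_derivative 0 - h t - G t (u t))
        (at t within {0..T})"
      unfolding H_def
      by (intro has_vector_derivative_diff has_vector_derivative_const
          integral_has_vector_derivative h_cont force_cont t)
    then show "((\<lambda>t. V t) has_vector_derivative ?w t) (at t within {0..T})"
      by (simp add: V_def [abs_def])
  qed (intro continuous_intros h_cont force_cont)
  have sub: "(p, - p) \<in> subdifferential j (u 0, u T)"
  proof (rule subdifferential_closed [OF j_lsc])
    show "(q N, - q N) \<in> subdifferential j (x N 0, x N (n N))" for N
      using sol by (simp add: discrete_sol_def)
    show "(\<lambda>N. (q N, - q N)) \<longlonglongrightarrow> (p, - p)" by (intro tendsto_intros q_lim)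
    show "(\<lambda>N. (x N 0, x N (n N))) \<longlonglongrightarrow> (u 0, u T)" by (intro tendsto_Pair x0_lim xn_lim)
  qed
  then show "(u 0, u T) \<in> subdiff_domain j" by (auto simp: subdiff_domain_def)
  \<comment> \<open>At T both integrals vanish, because h and the limit force have mean
    zero.\<close>
  have "V 0 = p" "V T = p" using force_mean h_mean by (auto simp: V_def H_def)
  with sub show "(\<phi> (?u' 0), - \<phi> (?u' T)) \<in> subdifferential j (u 0, u T)"
    by (simp add: phi_psi)
qed (simp_all add: norm_psi)

end

lemma (in periodic_bvp) solution_exists: "\<exists>u. is_solution T a \<phi> G h j u"
proof -
  obtain n \<tau> x q p u where *: "\<And>N. discrete_sol (n N) (\<tau> N) (x N) (q N)"
    "\<tau> \<longlonglongrightarrow> 0" "q \<longlonglongrightarrow> p" "continuous_on {0..T} u"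
    "uniform_limit {0..T} (\<lambda>N t. x N 0 + ramp_sum (\<tau> N) (n N) (slope (\<tau> N) (x N)) t) u sequentially"
    by (rule convergent_discrete_sols) blast
  interpret discrete_limit a \<phi> \<psi> \<Phi> j T B F G h n \<tau> x q u p
    by unfold_locales (rule *)+
  show ?thesis using limit_is_solution by blast
qed

section \<open>Translation by the period lattice\<close>

lemma periodic_of_int:
  fixes f :: "'a::real_vector \<Rightarrow> 'b"
  assumes "\<And>u. f (u + v) = f u"
  shows "f (u + of_int k *\<^sub>R v) = f u"
proof -
  have nat: "f (u + real m *\<^sub>R v) = f u" for m u
  proof (induction m)
    case (Suc m)
    have "u + real (Suc m) *\<^sub>R v = (u + real m *\<^sub>R v) + v" by (simp add: algebra_simps)
    then show ?case using Suc assms by (simp only:)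
  qed simp
  show ?thesis
  proof (cases k)
    case (nonneg m)
    then show ?thesis using nat by simp
  next
    case (neg m)
    \<comment> \<open>For negative \<open>k\<close> the forward case is applied at the translated
      point and leads back to \<open>u\<close>.\<close>
    then have "real_of_int k + real (Suc m) = 0" by simp
    then have "u + of_int k *\<^sub>R v + real (Suc m) *\<^sub>R v = u"
      by (metis add.assoc add.right_neutral scaleR_left.zero scaleR_left_distrib)
    then show ?thesis using nat [of "u + of_int k *\<^sub>R v" "Suc m"] by (simp only:)
  qed
qed

lemma periodic_sum:
  fixes f :: "'a::ab_group_add \<Rightarrow> 'b"
  assumes "finite I" and "\<And>i u. i \<in> I \<Longrightarrow> f (u + v i) = f u"
  shows "f (u + sum v I) = f u"
  using assms
proof (induction I arbitrary: u rule: finite_induct)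
  case (insert i I)
  then have "f ((u + v i) + sum v I) = f u" by simp
  then show ?case using insert.hyps by (simp add: add.assoc)
qed simp

lemma lattice_translation:
  fixes \<omega> c :: "real ^ 'n"
  assumes "\<And>i. 0 < \<omega> $ i"
  obtains k :: "'n \<Rightarrow> int" where
    "norm (c + (\<Sum>i\<in>UNIV. of_int (k i) *\<^sub>R axis i (\<omega> $ i))) \<le> (\<Sum>i\<in>UNIV. \<omega> $ i)"
proof -
  \<comment> \<open>This choice reduces each coordinate modulo its period into [0,
    \<omega>_i).\<close>
  define k where "k i = - \<lfloor>c $ i / \<omega> $ i\<rfloor>" for i
  have comp: "(c + (\<Sum>i\<in>UNIV. of_int (k i) *\<^sub>R axis i (\<omega> $ i))) $ m = c $ m + of_int (k m) * \<omega> $ m" for m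
    by (simp add: axis_def if_distrib [where f = "(*) _"] sum.delta' cong: if_cong)
  have "\<bar>c $ m + of_int (k m) * \<omega> $ m\<bar> \<le> \<omega> $ m" for m
  proof -
    have "c $ m + of_int (k m) * \<omega> $ m = frac (c $ m / \<omega> $ m) * \<omega> $ m"
      using assms [of m] by (simp add: k_def frac_def field_simps)
    moreover have "frac (c $ m / \<omega> $ m) * \<omega> $ m \<le> 1 * \<omega> $ m"
      using assms [of m] frac_lt_1 [of "c $ m / \<omega> $ m"] by (intro mult_right_mono) auto
    ultimately show ?thesis using assms [of m] by (simp add: less_imp_le)
  qed
  then have "norm (c + (\<Sum>i\<in>UNIV. of_int (k i) *\<^sub>R axis i (\<omega> $ i))) \<le> (\<Sum>i\<in>UNIV. \<omega> $ i)"
    by (intro order_trans [OF norm_le_l1_cart] sum_mono) (simp only: comp)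
  then show ?thesis by (rule that)
qed

theorem corollary4p6:
  fixes T a :: real
    and \<phi> :: "real ^ 'n \<Rightarrow> real ^ 'n"
    and \<Phi> :: "real ^ 'n \<Rightarrow> real"
    and F :: "real \<Rightarrow> real ^ 'n \<Rightarrow> real"
    and gradF :: "real \<Rightarrow> real ^ 'n \<Rightarrow> real ^ 'n"
    and j :: "(real ^ 'n) \<times> (real ^ 'n) \<Rightarrow> ereal"
    and \<omega> :: "real ^ 'n"
    and h :: "real \<Rightarrow> real ^ 'n"
  assumes T_pos: "0 < T"
    and a_pos: "0 < a"
    and phi_homeo: "\<exists>\<psi>. homeomorphism (ball 0 a) UNIV \<phi> \<psi>"
    and phi_0: "\<phi> 0 = 0"
    and phi_grad: "\<forall>x\<in>ball 0 a. GDERIV \<Phi> x :> \<phi> x"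
    and Phi_C1: "continuous_on (ball 0 a) \<phi>"
    and Phi_nonpos: "\<forall>x\<in>cball 0 a. \<Phi> x \<le> 0"
    and Phi_cont: "continuous_on (cball 0 a) \<Phi>"
    and Phi_convex: "strictly_convex_on (cball 0 a) \<Phi>"
    and F_cont: "continuous_on ({0..T} \<times> UNIV) (\<lambda>(t, u). F t u)"
    and F_grad: "\<forall>t\<in>{0..T}. \<forall>u. GDERIV (F t) u :> gradF t u"
    and gradF_cont: "continuous_on ({0..T} \<times> UNIV) (\<lambda>(t, u). gradF t u)"
    and F_0: "\<forall>t\<in>{0..T}. F t 0 = 0"
    and j_proper: "proper_fun j"
    and j_convex: "ereal_convex j"
    and j_lsc: "lower_semicontinuous j"
    and j_0: "j 0 = 0"
    and j_subdiff_0: "0 \<in> subdifferential j 0"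
    and j_diag: "\<forall>z\<in>eff_domain j. \<forall>\<zeta>\<in>diagonal. z + \<zeta> \<in> eff_domain j \<and> j (z + \<zeta>) = j z"
    and omega_pos: "\<forall>i. 0 < \<omega> $ i"
    and F_periodic: "\<forall>t\<in>{0..T}. \<forall>u i. F t (u + axis i (\<omega> $ i)) = F t u"
    and h_cont: "continuous_on {0..T} h"
    and h_mean: "(1 / T) *\<^sub>R integral {0..T} h = 0"
  shows "\<exists>u. is_solution T a \<phi> gradF h j u"
proof -
  obtain \<psi> where psi: "homeomorphism (ball 0 a) UNIV \<phi> \<psi>" using phi_homeo by blast
  have j_nonneg: "0 \<le> j z" for z
  proof -
    have "j 0 + ereal (0 \<bullet> (z - 0)) \<le> j z" using j_subdiff_0 unfolding subdifferential_def by blast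
    then show ?thesis using j_0 by (simp add: zero_ereal_def)
  qed
  have j_translate: "j (x + c, y + c) = j (x, y)" if "j (x, y) < \<infinity>" for x y c
    using j_diag that by (fastforce simp: eff_domain_def diagonal_def)
  have "singular_potential a \<phi> \<psi> \<Phi> j"
  proof
    \<comment> \<open>The hypothesis speaks only of points where \<open>j\<close> is finite. If
      \<open>j (x, y)\<close> is infinite, so is the translated value, since otherwise translating
      back by \<open>- c\<close> would give a finite one.\<close>
    show "j (x + c, y + c) = j (x, y)" for x y c
      using j_translate [of x y c] j_translate [of "x + c" "y + c" "- c"]
      by (cases "j (x, y) < \<infinity>") auto
  qed (use a_pos psi phi_0 phi_grad Phi_cont Phi_convex j_convex j_lsc j_0 j_nonneg in auto)
  moreover have "periodic_bvp_axioms T (\<Sum>i\<in>UNIV. \<omega> $ i) F gradF h"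
  proof
    fix c
    obtain k where k: "norm (c + (\<Sum>i\<in>UNIV. of_int (k i) *\<^sub>R axis i (\<omega> $ i))) \<le> (\<Sum>i\<in>UNIV. \<omega> $ i)"
      using lattice_translation omega_pos by blast
    have "F t (u + (\<Sum>i\<in>UNIV. of_int (k i) *\<^sub>R axis i (\<omega> $ i))) = F t u" if "t \<in> {0..T}" for t u
      using F_periodic that by (intro periodic_sum periodic_of_int) auto
    with k show "\<exists>l. norm (c + l) \<le> (\<Sum>i\<in>UNIV. \<omega> $ i) \<and> (\<forall>t\<in>{0..T}. \<forall>u. F t (u + l) = F t u)"
      by blast
  qed (use T_pos F_grad gradF_cont h_cont h_mean in auto)
  ultimately have "periodic_bvp a \<phi> \<psi> \<Phi> j T (\<Sum>i\<in>UNIV. \<omega> $ i) F gradF h"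
    by (rule periodic_bvp.intro)
  then show ?thesis by (rule periodic_bvp.solution_exists)
qed

end
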